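(* Let $V$ be a nonaxial 3D-rotation module for $\mathrm{Alt}(5)$ with respect to the axes $A_g=\mathrm{tr}_g(V)$ (for $g\in\mathrm{Alt}(5)\setminus\{1\}$). Suppose $V$ is uniquely $2$-divisible and either has prime characteristic or is divisible. Choose any involution $\alpha\in\mathrm{Alt}(5)$ and either conjugacy class $\mathcal{C}$ of $5$-cycles in $\mathrm{Alt}(5)$. Put $L=\mathrm{tr}_\alpha(V)$, and regard $L$ as a $\mathbb{Z}[\phi]$-module by letting $\phi$ act as the image in $\mathrm{End}(L)$ of $\frac14\sum_{g\in\mathcal{C}}g$ (in particular, this image satisfies $\phi^2=\phi+1$). Then $V\cong\mathrm{Icosa}(L)$ as $\mathrm{Alt}(5)$-modules, where $\mathrm{Icosa}(L)$ is formed with respect to a generating set $\{\alpha,\gamma\}$ of $\mathrm{Alt}(5)$ with $|\gamma|=3$ and $\alpha\gamma\in\mathcal{C}$.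
   Context: A $G$-module is an abelian group $V$ (written additively) on which the group $G$ acts on the left by automorphisms. For a subgroup $A\le V$, $C_G(A)=\{h\in G : ha=a \text{ for all } a\in A\}$ and $N_G(A)=\{h\in G: hA=A\}$. An element $h\in G$ inverts $A$ if $ha=-a$ for all $a\in A$. For $g\in G$ of finite order $m$, $\mathrm{tr}_g=1+g+\cdots+g^{m-1}\in\mathrm{End}(V)$. Definition (3D-rotation module). A $G$-module $V$ is a 3D-rotation module with respect to an assignment of a nontrivial subgroup $A_g\le V$ (the axis of $g$) to every nontrivial $g\in G$ if for all $g,h\in G\setminus\{1\}$: (1) $hA_g=A_{hgh^{-1}}$; (2) $h\in C_G(A_g)$ if and only if $A_h=A_g$; (3) if $h\in N_G(A_g)\setminus C_G(A_g)$, then $h$ inverts $A_g$. It is axial if some axis is $G$-invariant, and nonaxial otherwise. For an abelian group $V$ and a prime $p$: $V$ has characteristic $p$ if $V$ is an elementary abelian $p$-group, and $V$ has prime characteristic if it has characteristic $p$ for some prime $p$. $V$ is $p$-divisible if for every $v\in V$ there is $w\in V$ with $v=pw$; it is uniquely $p$-divisible if such $w$ is unique for each $v$. $V$ is divisible if it is $p$-divisible for all primes $p$. Unique $2$-divisibility makes multiplication by $\frac14$ meaningful; the sum of the elements of a conjugacy class commutes with the action of $\mathrm{Alt}(5)$, so it preserves $\mathrm{tr}_\alpha(V)$. Icosahedral modules. Let $R=\mathbb{Z}[\phi]$ with $\phi$ satisfying $\phi^2=\phi+1$. Fix a generating set $\{\alpha,\gamma\}$ of $\mathrm{Alt}(5)$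 with $|\alpha|=2$, $|\gamma|=3$, $|\alpha\gamma|=5$. Then $\mathrm{Icosa}(R)$ (with respect to $\alpha,\gamma$) is the $R[\mathrm{Alt}(5)]$-module $Re_1\oplus Re_2\oplus Re_3$, free over $R$ on $e_1,e_2,e_3$, with action $\alpha e_1=-e_1+\phi e_3$, $\alpha e_2=-e_2+\phi e_3$, $\alpha e_3=e_3$, $\gamma e_1=e_3$, $\gamma e_2=e_1$, $\gamma e_3=e_2$. For an $R$-module $L$ without $2$-torsion, $\mathrm{Icosa}(L)=\mathrm{Icosa}(R)\otimes_R L$ with $\mathrm{Alt}(5)$ acting trivially on $L$. *)

theory Defs
  imports "HOL-Algebra.Algebra"
begin

section \<open>Modules over a group\<close>

text \<open>The \<open>G\<close>-module is an additive abelian group given by a whole type of class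
  \<open>ab_group_add\<close>; the following is that group as a record of HOL-Algebra.\<close>

definition add_group :: "'v::ab_group_add monoid"
  where "add_group = \<lparr>carrier = UNIV, monoid.mult = (+), one = 0\<rparr>"

definition gmodule ::
    "('g, 'x) monoid_scheme \<Rightarrow> ('v, 'y) monoid_scheme \<Rightarrow> ('g \<Rightarrow> 'v \<Rightarrow> 'v) \<Rightarrow> bool"
  where "gmodule G V act \<longleftrightarrow> group G \<and> comm_group V \<and> act \<in> hom G (AutoGroup V)"

definition gmodule_isomorphic ::
    "('g, 'x) monoid_scheme \<Rightarrow> ('v, 'y) monoid_scheme \<Rightarrow> ('g \<Rightarrow> 'v \<Rightarrow> 'v)
      \<Rightarrow> ('w, 'z) monoid_scheme \<Rightarrow> ('g \<Rightarrow> 'w \<Rightarrow> 'w) \<Rightarrow> bool"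
  where "gmodule_isomorphic G V act W act' \<longleftrightarrow>
    (\<exists>f \<in> iso V W. \<forall>g \<in> carrier G. \<forall>v \<in> carrier V. f (act g v) = act' g (f v))"

definition pointwise_centralizer ::
    "('g, 'x) monoid_scheme \<Rightarrow> ('g \<Rightarrow> 'v \<Rightarrow> 'v) \<Rightarrow> 'v set \<Rightarrow> 'g set"
  where "pointwise_centralizer G act A = {h \<in> carrier G. \<forall>a \<in> A. act h a = a}"

definition setwise_normalizer ::
    "('g, 'x) monoid_scheme \<Rightarrow> ('g \<Rightarrow> 'v \<Rightarrow> 'v) \<Rightarrow> 'v set \<Rightarrow> 'g set"
  where "setwise_normalizer G act A = {h \<in> carrier G. act h ` A = A}"

definition trace_map ::
    "('g, 'x) monoid_scheme \<Rightarrow> ('g \<Rightarrow> 'v \<Rightarrow> 'v) \<Rightarrow> 'g \<Rightarrow> 'v \<Rightarrow> 'v::ab_group_add"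
  where "trace_map G act g v = (\<Sum>i<group.ord G g. act (g [^]\<^bsub>G\<^esub> i) v)"

definition conj_class :: "('g, 'x) monoid_scheme \<Rightarrow> 'g \<Rightarrow> 'g set"
  where "conj_class G g = {h \<otimes>\<^bsub>G\<^esub> g \<otimes>\<^bsub>G\<^esub> inv\<^bsub>G\<^esub> h | h. h \<in> carrier G}"


section \<open>3D-rotation modules\<close>

definition rotation_module_3D ::
    "('g, 'x) monoid_scheme \<Rightarrow> ('g \<Rightarrow> 'v::ab_group_add \<Rightarrow> 'v) \<Rightarrow> ('g \<Rightarrow> 'v set) \<Rightarrow> bool"
  where "rotation_module_3D G act A \<longleftrightarrow>
    gmodule G (add_group :: 'v monoid) act \<and>
    (\<forall>g \<in> carrier G - {\<one>\<^bsub>G\<^esub>}. subgroup (A g) add_group \<and> A g \<noteq> {0}) \<and>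
    (\<forall>g \<in> carrier G - {\<one>\<^bsub>G\<^esub>}. \<forall>h \<in> carrier G - {\<one>\<^bsub>G\<^esub>}.
       act h ` A g = A (h \<otimes>\<^bsub>G\<^esub> g \<otimes>\<^bsub>G\<^esub> inv\<^bsub>G\<^esub> h) \<and>
       (h \<in> pointwise_centralizer G act (A g) \<longleftrightarrow> A h = A g) \<and>
       (h \<in> setwise_normalizer G act (A g) - pointwise_centralizer G act (A g) \<longrightarrow>
          (\<forall>a \<in> A g. act h a = - a)))"

definition axial ::
    "('g, 'x) monoid_scheme \<Rightarrow> ('g \<Rightarrow> 'v \<Rightarrow> 'v) \<Rightarrow> ('g \<Rightarrow> 'v set) \<Rightarrow> bool"
  where "axial G act A \<longleftrightarrow>
    (\<exists>g \<in> carrier G - {\<one>\<^bsub>G\<^esub>}. \<forall>h \<in> carrier G. act h ` A g = A g)"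


section \<open>Divisibility and characteristic of abelian groups\<close>

definition nmult :: "nat \<Rightarrow> 'v \<Rightarrow> 'v::ab_group_add"
  where "nmult n v = (\<Sum>i<n. v)"

definition zmult :: "int \<Rightarrow> 'v \<Rightarrow> 'v::ab_group_add"
  where "zmult k v = nmult (nat k) v - nmult (nat (- k)) v"

definition p_divisible :: "'v::ab_group_add itself \<Rightarrow> nat \<Rightarrow> bool"
  where "p_divisible _ p \<longleftrightarrow> (\<forall>v::'v. \<exists>w. v = nmult p w)"

definition uniquely_p_divisible :: "'v::ab_group_add itself \<Rightarrow> nat \<Rightarrow> bool"
  where "uniquely_p_divisible _ p \<longleftrightarrow> (\<forall>v::'v. \<exists>!w. v = nmult p w)"

definition divisible :: "'v::ab_group_add itself \<Rightarrow> bool"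
  where "divisible T \<longleftrightarrow> (\<forall>p. Factorial_Ring.prime p \<longrightarrow> p_divisible T p)"

definition has_characteristic :: "'v::ab_group_add itself \<Rightarrow> nat \<Rightarrow> bool"
  where "has_characteristic _ p \<longleftrightarrow> (\<forall>v::'v. nmult p v = 0)"

definition prime_characteristic :: "'v::ab_group_add itself \<Rightarrow> bool"
  where "prime_characteristic T \<longleftrightarrow> (\<exists>p. Factorial_Ring.prime p \<and> has_characteristic T p)"

text \<open>Meaningful only in uniquely 2-divisible groups, where the solution exists and is unique.\<close>

definition quarter :: "'v \<Rightarrow> 'v::ab_group_add"
  where "quarter v = (THE w. v = nmult 4 w)"


section \<open>The ring of golden integers\<close>

text \<open>The pair \<open>(a, b)\<close> stands for \<open>a + b \<phi>\<close>, where \<open>\<phi>\<^sup>2 = \<phi> + 1\<close>.\<close>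

type_synonym golden = "int \<times> int"

definition golden_ring :: "golden ring"
  where "golden_ring =
    \<lparr>carrier = UNIV,
     monoid.mult = \<lambda>(a, b) (c, d). (a * c + b * d, a * d + b * c + b * d),
     one = (1, 0),
     ring.zero = (0, 0),
     add = \<lambda>(a, b) (c, d). (a + c, b + d)\<rparr>"

definition golden_phi :: golden
  where "golden_phi = (0, 1)"

lemma golden_phi_square:
  "golden_phi \<otimes>\<^bsub>golden_ring\<^esub> golden_phi = golden_phi \<oplus>\<^bsub>golden_ring\<^esub> \<one>\<^bsub>golden_ring\<^esub>"
  by (simp add: golden_ring_def golden_phi_def)

lemma cring_golden_ring: "cring golden_ring"
proof (rule cringI)
  show "abelian_group golden_ring"
  proof (rule abelian_groupI)
    fix x :: golden
    obtain a b where x: "x = (a, b)"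
      by (cases x)
    show "\<exists>y \<in> carrier golden_ring. y \<oplus>\<^bsub>golden_ring\<^esub> x = \<zero>\<^bsub>golden_ring\<^esub>"
      by (rule bexI[where x = "(- a, - b)"]) (auto simp: golden_ring_def x)
  qed (auto simp: golden_ring_def)
  show "Group.comm_monoid golden_ring"
    by (rule comm_monoidI) (auto simp: golden_ring_def algebra_simps)
qed (auto simp: golden_ring_def algebra_simps)


section \<open>Tensor products\<close>

text \<open>The tensor product of two modules over a commutative ring \<open>R\<close>, as an abelian group: the
  free abelian group on \<open>M \<times> N\<close> modulo the subgroup generated by the bilinearity relations.\<close>

definition tensor_free ::
    "('m, 'x) ring_scheme \<Rightarrow> ('n, 'y) ring_scheme \<Rightarrow> ('m \<times> 'n \<Rightarrow>\<^sub>0 int) monoid"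
  where "tensor_free M N = free_Abelian_group (carrier M \<times> carrier N)"

definition tensor_relations ::
    "('r, 'x) ring_scheme \<Rightarrow> ('r, 'm) module \<Rightarrow> ('r, 'n) module \<Rightarrow> ('m \<times> 'n \<Rightarrow>\<^sub>0 int) set"
  where "tensor_relations R M N =
    {frag_of (x \<oplus>\<^bsub>M\<^esub> y, n) - frag_of (x, n) - frag_of (y, n) | x y n.
       x \<in> carrier M \<and> y \<in> carrier M \<and> n \<in> carrier N} \<union>
    {frag_of (x, m \<oplus>\<^bsub>N\<^esub> n) - frag_of (x, m) - frag_of (x, n) | x m n.
       x \<in> carrier M \<and> m \<in> carrier N \<and> n \<in> carrier N} \<union>
    {frag_of (r \<odot>\<^bsub>M\<^esub> x, n) - frag_of (x, r \<odot>\<^bsub>N\<^esub> n) | r x n.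
       r \<in> carrier R \<and> x \<in> carrier M \<and> n \<in> carrier N}"

definition tensor_kernel ::
    "('r, 'x) ring_scheme \<Rightarrow> ('r, 'm) module \<Rightarrow> ('r, 'n) module \<Rightarrow> ('m \<times> 'n \<Rightarrow>\<^sub>0 int) set"
  where "tensor_kernel R M N = generate (tensor_free M N) (tensor_relations R M N)"

definition tensor_product ::
    "('r, 'x) ring_scheme \<Rightarrow> ('r, 'm) module \<Rightarrow> ('r, 'n) module \<Rightarrow> ('m \<times> 'n \<Rightarrow>\<^sub>0 int) set monoid"
  where "tensor_product R M N = tensor_free M N Mod tensor_kernel R M N"

text \<open>The endomorphism \<open>f \<otimes> id\<close> of \<open>M \<otimes> N\<close> induced by an \<open>R\<close>-linear \<open>f : M \<rightarrow> M\<close>: it sends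
  the coset of \<open>c\<close> to the coset of the image of \<open>c\<close> under \<open>(x, n) \<mapsto> (f x, n)\<close>.\<close>

definition tensor_left_map ::
    "('r, 'x) ring_scheme \<Rightarrow> ('r, 'm) module \<Rightarrow> ('r, 'n) module \<Rightarrow> ('m \<Rightarrow> 'm)
      \<Rightarrow> ('m \<times> 'n \<Rightarrow>\<^sub>0 int) set \<Rightarrow> ('m \<times> 'n \<Rightarrow>\<^sub>0 int) set"
  where "tensor_left_map R M N f S =
    set_mult (tensor_free M N) (tensor_kernel R M N)
      (frag_extend (\<lambda>(x, n). frag_of (f x, n)) ` S)"


section \<open>Icosahedral modules\<close>

abbreviation Alt5 :: "(nat \<Rightarrow> nat) monoid"
  where "Alt5 \<equiv> alt_group 5"

abbreviation five_cycles :: "(nat \<Rightarrow> nat) set"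
  where "five_cycles \<equiv> {cycle_of_list cs | cs. cycle cs \<and> length cs = 5 \<and> set cs \<subseteq> {1..5}}"

definition icosa_generators :: "(nat \<Rightarrow> nat) \<Rightarrow> (nat \<Rightarrow> nat) \<Rightarrow> bool"
  where "icosa_generators \<alpha> \<gamma> \<longleftrightarrow>
    \<alpha> \<in> carrier Alt5 \<and> \<gamma> \<in> carrier Alt5 \<and> generate Alt5 {\<alpha>, \<gamma>} = carrier Alt5 \<and>
    group.ord Alt5 \<alpha> = 2 \<and> group.ord Alt5 \<gamma> = 3 \<and> group.ord Alt5 (\<alpha> \<otimes>\<^bsub>Alt5\<^esub> \<gamma>) = 5"

text \<open>The free module of rank 3 over the golden integers.\<close>

definition icosa_lattice :: "(golden, golden \<times> golden \<times> golden) module"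
  where "icosa_lattice =
    \<lparr>carrier = UNIV,
     monoid.mult = undefined,
     one = undefined,
     ring.zero = (\<zero>\<^bsub>golden_ring\<^esub>, \<zero>\<^bsub>golden_ring\<^esub>, \<zero>\<^bsub>golden_ring\<^esub>),
     add = \<lambda>(x, y, z) (x', y', z').
       (x \<oplus>\<^bsub>golden_ring\<^esub> x', y \<oplus>\<^bsub>golden_ring\<^esub> y', z \<oplus>\<^bsub>golden_ring\<^esub> z'),
     smult = \<lambda>r (x, y, z).
       (r \<otimes>\<^bsub>golden_ring\<^esub> x, r \<otimes>\<^bsub>golden_ring\<^esub> y, r \<otimes>\<^bsub>golden_ring\<^esub> z)\<rparr>"

definition e1 :: "golden \<times> golden \<times> golden"
  where "e1 = (\<one>\<^bsub>golden_ring\<^esub>, \<zero>\<^bsub>golden_ring\<^esub>, \<zero>\<^bsub>golden_ring\<^esub>)"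

definition e2 :: "golden \<times> golden \<times> golden"
  where "e2 = (\<zero>\<^bsub>golden_ring\<^esub>, \<one>\<^bsub>golden_ring\<^esub>, \<zero>\<^bsub>golden_ring\<^esub>)"

definition e3 :: "golden \<times> golden \<times> golden"
  where "e3 = (\<zero>\<^bsub>golden_ring\<^esub>, \<zero>\<^bsub>golden_ring\<^esub>, \<one>\<^bsub>golden_ring\<^esub>)"

lemma module_icosa_lattice: "module golden_ring icosa_lattice"
proof (rule moduleI)
  show "cring golden_ring"
    by (rule cring_golden_ring)
  show "abelian_group icosa_lattice"
  proof (rule abelian_groupI)
    fix x :: "golden \<times> golden \<times> golden"
    obtain a b c d e f where x: "x = ((a, b), (c, d), (e, f))"
      by (metis surj_pair)
    show "\<exists>y \<in> carrier icosa_lattice. y \<oplus>\<^bsub>icosa_lattice\<^esub> x = \<zero>\<^bsub>icosa_lattice\<^esub>"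
      by (rule bexI[where x = "((- a, - b), (- c, - d), (- e, - f))"])
        (auto simp: icosa_lattice_def golden_ring_def x)
  qed (auto simp: icosa_lattice_def golden_ring_def)
qed (auto simp: icosa_lattice_def golden_ring_def algebra_simps)

definition icosa_lattice_action ::
    "(nat \<Rightarrow> nat) \<Rightarrow> (nat \<Rightarrow> nat)
      \<Rightarrow> ((nat \<Rightarrow> nat) \<Rightarrow> golden \<times> golden \<times> golden \<Rightarrow> golden \<times> golden \<times> golden) \<Rightarrow> bool"
  where "icosa_lattice_action \<alpha> \<gamma> \<rho> \<longleftrightarrow>
    gmodule Alt5 (add_monoid icosa_lattice) \<rho> \<and>
    (\<forall>g \<in> carrier Alt5. \<forall>r x. \<rho> g (r \<odot>\<^bsub>icosa_lattice\<^esub> x) = r \<odot>\<^bsub>icosa_lattice\<^esub> \<rho> g x) \<and>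
    \<rho> \<alpha> e1 = \<ominus>\<^bsub>icosa_lattice\<^esub> e1 \<oplus>\<^bsub>icosa_lattice\<^esub> golden_phi \<odot>\<^bsub>icosa_lattice\<^esub> e3 \<and>
    \<rho> \<alpha> e2 = \<ominus>\<^bsub>icosa_lattice\<^esub> e2 \<oplus>\<^bsub>icosa_lattice\<^esub> golden_phi \<odot>\<^bsub>icosa_lattice\<^esub> e3 \<and>
    \<rho> \<alpha> e3 = e3 \<and>
    \<rho> \<gamma> e1 = e3 \<and> \<rho> \<gamma> e2 = e1 \<and> \<rho> \<gamma> e3 = e2"

text \<open>For \<open>icosa_generators \<alpha> \<gamma>\<close> such an action exists and is determined on \<open>Alt5\<close>, because
  \<open>\<alpha>\<close> and \<open>\<gamma>\<close> generate; extensionality fixes the irrelevant values outside \<open>Alt5\<close>.\<close>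

definition icosa_action ::
    "(nat \<Rightarrow> nat) \<Rightarrow> (nat \<Rightarrow> nat)
      \<Rightarrow> (nat \<Rightarrow> nat) \<Rightarrow> golden \<times> golden \<times> golden \<Rightarrow> golden \<times> golden \<times> golden"
  where "icosa_action \<alpha> \<gamma> =
    (THE \<rho>. \<rho> \<in> extensional (carrier Alt5) \<and> icosa_lattice_action \<alpha> \<gamma> \<rho>)"

definition Icosa ::
    "(golden, 'l) module \<Rightarrow> ((golden \<times> golden \<times> golden) \<times> 'l \<Rightarrow>\<^sub>0 int) set monoid"
  where "Icosa L = tensor_product golden_ring icosa_lattice L"

definition Icosa_act ::
    "(nat \<Rightarrow> nat) \<Rightarrow> (nat \<Rightarrow> nat) \<Rightarrow> (golden, 'l) module \<Rightarrow> (nat \<Rightarrow> nat)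
      \<Rightarrow> ((golden \<times> golden \<times> golden) \<times> 'l \<Rightarrow>\<^sub>0 int) set
      \<Rightarrow> ((golden \<times> golden \<times> golden) \<times> 'l \<Rightarrow>\<^sub>0 int) set"
  where "Icosa_act \<alpha> \<gamma> L g =
    tensor_left_map golden_ring icosa_lattice L (icosa_action \<alpha> \<gamma> g)"


section \<open>The golden module carried by an axis\<close>

definition phi_endo :: "((nat \<Rightarrow> nat) \<Rightarrow> 'v \<Rightarrow> 'v) \<Rightarrow> (nat \<Rightarrow> nat) set \<Rightarrow> 'v \<Rightarrow> 'v::ab_group_add"
  where "phi_endo act C v = quarter (\<Sum>g\<in>C. act g v)"

definition axis_module ::
    "((nat \<Rightarrow> nat) \<Rightarrow> 'v \<Rightarrow> 'v) \<Rightarrow> (nat \<Rightarrow> nat) \<Rightarrow> (nat \<Rightarrow> nat) set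
      \<Rightarrow> (golden, 'v::ab_group_add) module"
  where "axis_module act \<alpha> C =
    \<lparr>carrier = range (trace_map Alt5 act \<alpha>),
     monoid.mult = undefined,
     one = undefined,
     ring.zero = 0,
     add = (+),
     smult = \<lambda>(a, b) l. zmult a l + zmult b (phi_endo act C l)\<rparr>"

end

theory Submission
  imports Defs
begin

text \<open>The proof turns the axis condition into one identity on \<open>V\<close> and reads everything off from it.

  Let \<open>\<alpha>\<close>, \<open>\<beta>\<close> be distinct commuting involutions. Since \<open>\<beta>\<close> normalizes the axis
  \<open>A\<^sub>\<alpha>\<close>, it inverts this axis unless \<open>A\<^sub>\<beta> = A\<^sub>\<alpha>\<close>. In the second case an element \<open>\<sigma>\<close> of
  order three that conjugates \<open>\<alpha>\<close> to \<open>\<beta>\<close> shares the axis as well, hence the normalizer of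
  \<open>\<langle>\<sigma>\<rangle>\<close> preserves it. Together with \<open>\<alpha>\<close> and \<open>\<beta>\<close> this normalizer generates the group, so
  the module would be axial (\<open>commuting_involution_inverts_axis\<close>). So \<open>\<beta>\<close> inverts \<open>A\<^sub>\<alpha> = (1 + \<alpha>) V\<close>, that is,
  \<open>1 + \<alpha> + \<beta> + \<beta>\<alpha> = 0\<close> on \<open>V\<close> (\<open>klein_four_norm\<close>), and the same holds for every Klein
  four-group.

  For \<open>l\<close> in \<open>L = A\<^sub>\<alpha>\<close> put \<open>T\<^sub>p l = (1 + \<alpha>) p l\<close>, twice the component of \<open>p l\<close> along the
  axis. As \<open>\<langle>\<alpha>, \<beta>\<rangle>\<close> acts on \<open>L\<close> by signs, \<open>T\<^sub>p\<close> depends up to sign only on the double coset of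
  \<open>p\<close>, which leaves three unknown endomorphisms. Conjugates of the Klein four identity give linear
  relations among them, and two of these already express all three by \<open>F = T\<^sub>\<gamma>\<close>: the others are
  \<open>F - 1\<close> and \<open>- 1\<close> (\<open>T_delta0\<close>, \<open>T_epsilon0\<close>). Then \<open>F\<^sup>2 = F + 1\<close> (\<open>T_T_gamma0\<close>), and
  summing over a class of 5-cycles gives \<open>4 F\<close> (\<open>class_sum_eq_T\<close>), so \<open>F\<close> is the prescribed
  action of \<open>\<phi>\<close>. The equations \<open>T\<^sub>\<gamma> = F\<close> and \<open>T\<^sub>p = F\<close> for \<open>p = \<gamma>\<^sup>-\<^sup>1\<close> are exactly
  the defining formulas of the icosahedral lattice, read on \<open>\<gamma>\<^sup>2 l\<^sub>1 + \<gamma> l\<^sub>2 + l\<^sub>3\<close>.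

  It remains to see that \<open>V\<close> is the direct sum of \<open>\<gamma>\<^sup>2 L\<close>, \<open>\<gamma> L\<close> and \<open>L\<close>. The sum is direct
  because the Gram matrix with diagonal \<open>2\<close> and off-diagonal entries \<open>\<phi>\<close> is invertible over
  \<open>\<int>[\<phi>, 1/2]\<close> (\<open>from_axes_eq_0\<close>); it is everything because it is a submodule that contains
  the axes of three commuting involutions (\<open>from_axes_surj\<close>). The identification with the tensor
  product is then formal (\<open>Icosa_isomorphic\<close>), once the lattice is known to carry its action at
  all; that action is realized on functions on the twelve vertices of the icosahedron
  (\<open>icosa_action0_lattice_action\<close>).

  All computations in the group are made for one explicit pair of generators; an arbitrary pair is
  conjugate to it in the symmetric group (\<open>icosa_generators_conj_standard\<close>).\<close>


section \<open>Permutations of five points\<close>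

abbreviation A5 :: "(nat \<Rightarrow> nat) set"
  where "A5 \<equiv> carrier Alt5"

text \<open>One-line notation. Composition and equality of such permutations reduce to numerals, so
  every concrete identity in the group becomes a goal for the simplifier.\<close>

definition perm5 :: "nat \<Rightarrow> nat \<Rightarrow> nat \<Rightarrow> nat \<Rightarrow> nat \<Rightarrow> nat \<Rightarrow> nat" where
  "perm5 a b c d e = (\<lambda>i. if i = 1 then a else if i = 2 then b else if i = 3 then c
     else if i = 4 then d else if i = 5 then e else i)"

lemma perm5_apply [simp]:
  "perm5 a b c d e (Suc 0) = a" "perm5 a b c d e 2 = b" "perm5 a b c d e 3 = c"
  "perm5 a b c d e 4 = d" "perm5 a b c d e 5 = e"
  by (simp_all add: perm5_def)

lemma perm5_outside: "i \<notin> {1..5} \<Longrightarrow> perm5 a b c d e i = i"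
  by (auto simp: perm5_def)

lemma cases5:
  assumes "i \<in> {1..5}"
  obtains "i = (1::nat)" | "i = 2" | "i = 3" | "i = 4" | "i = 5"
  using assms by fastforce

lemma perm5_comp_any:
  "(\<And>i. i \<notin> {1..5} \<Longrightarrow> p i = i) \<Longrightarrow> p \<circ> perm5 a b c d e = perm5 (p a) (p b) (p c) (p d) (p e)"
  by (auto simp: perm5_def fun_eq_iff)

lemma perm5_comp [simp]:
  "perm5 a' b' c' d' e' \<circ> perm5 a b c d e =
   perm5 (perm5 a' b' c' d' e' a) (perm5 a' b' c' d' e' b) (perm5 a' b' c' d' e' c)
     (perm5 a' b' c' d' e' d) (perm5 a' b' c' d' e' e)"
  by (rule perm5_comp_any) (rule perm5_outside)

lemma perm5_eq_iff [simp]: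
  "perm5 a b c d e = perm5 a' b' c' d' e' \<longleftrightarrow> a = a' \<and> b = b' \<and> c = c' \<and> d = d' \<and> e = e'"
  by (metis perm5_apply)

lemma id_eq_perm5: "id = perm5 1 2 3 4 5"
  by (auto simp: perm5_def fun_eq_iff)

text \<open>The standard elements are \<open>\<alpha> = (1 2)(3 4)\<close>, \<open>\<beta> = (1 3)(2 4)\<close>, which completes the
  Klein four-group of \<open>\<alpha>\<close>, and the 3-cycle \<open>\<gamma> = (1 3 5)\<close>.\<close>

definition alpha0 where "alpha0 = perm5 2 1 4 3 5"
definition beta0 where "beta0 = perm5 3 4 1 2 5"
definition gamma0 where "gamma0 = perm5 3 2 5 4 1"

lemmas gen0_defs = alpha0_def beta0_def gamma0_def

lemma alpha0_transp: "alpha0 = transpose 1 2 \<circ> transpose 3 4"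
  by (auto simp: alpha0_def perm5_def transpose_def fun_eq_iff)

lemma gamma0_transp: "gamma0 = transpose 1 3 \<circ> transpose 3 5"
  by (auto simp: gamma0_def perm5_def transpose_def fun_eq_iff)

lemma alt5_group: "group Alt5" by (rule alt_group_is_group)

lemma alt5_comp: "p \<in> A5 \<Longrightarrow> q \<in> A5 \<Longrightarrow> p \<circ> q \<in> A5"
  using group.subgroup_self[OF alt5_group] monoid.m_closed[OF group.is_monoid[OF alt5_group]]
  by (metis alt_group_mult)

lemma alt5_inv: "p \<in> A5 \<Longrightarrow> inv' p \<in> A5"
  by (rule alt_group_inv_closed)

lemma alt5_id: "id \<in> A5"
  using group.is_monoid[OF alt5_group] monoid.one_closed alt_group_one by metis

lemma double_transposition_in_alt5:
  assumes "a \<in> {1..5}" "b \<in> {1..5}" "c \<in> {1..5}" "d \<in> {1..5}" "a \<noteq> b" "c \<noteq> d"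
  shows "transpose a b \<circ> transpose c d \<in> A5"
  using assms by (auto simp: alt_group_carrier evenperm_comp permutation_swap_id evenperm_swap
      intro!: permutes_compose permutes_swap_id)

lemma alpha0_in: "alpha0 \<in> A5"
  unfolding alpha0_transp by (rule double_transposition_in_alt5) auto

lemma gamma0_in: "gamma0 \<in> A5"
  unfolding gamma0_transp by (rule double_transposition_in_alt5) auto

lemma beta0_word:
  "beta0 = gamma0 \<circ> alpha0 \<circ> gamma0 \<circ> gamma0 \<circ> alpha0 \<circ> gamma0 \<circ> alpha0 \<circ> gamma0 \<circ> gamma0 \<circ> alpha0 \<circ> gamma0 \<circ> alpha0"
  by (simp add: gen0_defs)

lemma beta0_in: "beta0 \<in> A5"
  unfolding beta0_word by (intro alt5_comp alpha0_in gamma0_in)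

lemma alt5_mult [simp]: "p \<otimes>\<^bsub>Alt5\<^esub> q = p \<circ> q"
  by (simp add: alt_group_mult)

lemma alt5_one [simp]: "\<one>\<^bsub>Alt5\<^esub> = id"
  by (simp add: alt_group_one)

lemma alt5_m_inv: "p \<in> A5 \<Longrightarrow> inv\<^bsub>Alt5\<^esub> p = inv' p"
  by (rule alt_group_inv_equality)

lemma alt5_permutes: "p \<in> A5 \<Longrightarrow> p permutes {1..5}"
  by (simp add: alt_group_carrier)

lemma alt5_bij: "p \<in> A5 \<Longrightarrow> bij p"
  using alt5_permutes permutes_bij by blast

lemma alt5_card: "card A5 = 60"
  using alt_group_card_carrier[of 5] by (simp add: fact_numeral)

lemma pow_eq_funpow:
  "monoid.mult G = (\<circ>) \<Longrightarrow> monoid.one G = id \<Longrightarrow> p [^]\<^bsub>G\<^esub> (n::nat) = p ^^ n"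
  by (induction n) (simp_all add: nat_pow_def funpow_Suc_right del: funpow.simps(2))

lemma ord_eq_prime:
  assumes "group G" "monoid.mult G = (\<circ>)" "monoid.one G = id"
    and "p \<in> carrier G" "p \<noteq> id" "p ^^ n = id" "Factorial_Ring.prime n"
  shows "group.ord G p = n"
proof -
  interpret group G by fact
  have "ord p dvd n"
    using pow_eq_id[of p n] assms by (simp add: pow_eq_funpow)
  moreover have "ord p \<noteq> 1"
    using ord_eq_1[of p] assms by simp
  ultimately show ?thesis
    using assms(7) by (metis One_nat_def prime_nat_iff)
qed

lemmas alt5_ord_prime = ord_eq_prime[OF alt5_group alt_group_mult alt_group_one]

lemma alt5_pow_ord: "p \<in> A5 \<Longrightarrow> p ^^ group.ord Alt5 p = id"
  using group.pow_ord_eq_1[OF alt5_group, of p] by (simp add: pow_eq_funpow alt_group_mult)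

lemma funpow_small:
  "p ^^ 2 = p \<circ> p" "p ^^ 3 = p \<circ> p \<circ> p" "p ^^ 5 = p \<circ> p \<circ> p \<circ> p \<circ> p"
  by (simp_all add: eval_nat_numeral comp_assoc)

lemma gen0_powers:
  "alpha0 ^^ 2 = id" "gamma0 ^^ 3 = id" "(alpha0 \<circ> gamma0) ^^ 5 = id"
  "alpha0 \<noteq> id" "gamma0 \<noteq> id" "alpha0 \<circ> gamma0 \<noteq> id"
  by (simp_all add: funpow_small gen0_defs id_eq_perm5)

lemma gen0_ord:
  "group.ord Alt5 alpha0 = 2" "group.ord Alt5 gamma0 = 3" "group.ord Alt5 (alpha0 \<circ> gamma0) = 5"
  by (intro alt5_ord_prime gen0_powers alpha0_in gamma0_in alt5_comp; simp)+

text \<open>A subgroup that contains a Klein four-group, an element of order 3 and one of order 5 has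
  order divisible by 60.\<close>

lemma alt5_generated: "generate Alt5 {alpha0, gamma0} = A5"
proof -
  interpret G: group Alt5 by (rule alt5_group)
  let ?S = "generate Alt5 {alpha0, gamma0}"
  have sub: "subgroup ?S Alt5"
    by (rule G.generate_is_subgroup) (use alpha0_in gamma0_in in auto)
  have comp: "p \<circ> q \<in> ?S" if "p \<in> ?S" "q \<in> ?S" for p q
    using generate.eng[OF that] by simp
  have ag: "alpha0 \<in> ?S" "gamma0 \<in> ?S"
    by (auto intro: generate.incl)
  have b: "beta0 \<in> ?S"
    unfolding beta0_word by (intro comp ag)
  let ?H = "Alt5\<lparr>carrier := ?S\<rparr>"
  interpret H: group ?H
    by (rule G.subgroup_imp_group[OF sub])
  have fin: "finite A5" using alt5_card card.infinite by fastforce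
  have finS: "finite ?S" using finite_subset[OF subgroup.subset[OF sub] fin] .
  have ord: "H.ord p = n" if "p \<in> ?S" "p \<noteq> id" "p ^^ n = id" "Factorial_Ring.prime n" for p n
    by (rule ord_eq_prime) (use that in \<open>auto simp: H.group_axioms alt_group_mult\<close>)
  have "3 dvd card ?S"
    using H.ord_dvd_group_order[of gamma0] ag ord[of gamma0 3] gen0_powers by (simp add: order_def)
  moreover have "5 dvd card ?S"
    using H.ord_dvd_group_order[of "alpha0 \<circ> gamma0"] ag ord[of "alpha0 \<circ> gamma0" 5] comp
      gen0_powers by (simp add: order_def)
  moreover have "4 dvd card ?S"
  proof -
    let ?K = "{id, alpha0, beta0, alpha0 \<circ> beta0}"
    have "subgroup ?K ?H"
    proof (rule H.subgroupI)
      show "?K \<subseteq> carrier ?H"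
        using ag b comp generate.one[of Alt5 "{alpha0, gamma0}"] by simp
      fix x assume x: "x \<in> ?K"
      have xx: "x \<circ> x = id"
        using x by (auto simp: gen0_defs id_eq_perm5)
      have "inv\<^bsub>?H\<^esub> x = x"
        using x ag b comp xx by (intro H.inv_equality) (auto simp: generate.one[of Alt5, simplified])
      then show "inv\<^bsub>?H\<^esub> x \<in> ?K" using x by simp
    next
      fix x y assume "x \<in> ?K" "y \<in> ?K"
      then show "x \<otimes>\<^bsub>?H\<^esub> y \<in> ?K"
        by (auto simp: gen0_defs id_eq_perm5)
    qed auto
    from H.lagrange[OF this] have "card ?K dvd card ?S"
      by (simp add: order_def) (metis dvd_triv_right)
    moreover have "card ?K = 4"
      by (simp add: gen0_defs id_eq_perm5)
    ultimately show ?thesis by simp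
  qed
  ultimately have "60 dvd card ?S"
    by presburger
  moreover have "card ?S \<le> 60"
    using card_mono[OF fin subgroup.subset[OF sub]] alt5_card by simp
  moreover have "card ?S \<noteq> 0"
    using finS ag by auto
  ultimately have "card ?S = 60"
    using dvd_imp_le by (simp add: dvd_imp_le le_antisym)
  then show ?thesis
    using card_subset_eq[OF fin subgroup.subset[OF sub]] alt5_card by simp
qed

section \<open>Generating pairs up to relabelling\<close>

definition conj_by :: "('a \<Rightarrow> 'a) \<Rightarrow> ('a \<Rightarrow> 'a) \<Rightarrow> 'a \<Rightarrow> 'a" where
  "conj_by x p = x \<circ> p \<circ> inv' x"

lemma conj_by_comp: "bij x \<Longrightarrow> conj_by x (p \<circ> q) = conj_by x p \<circ> conj_by x q"
  by (auto simp: conj_by_def fun_eq_iff bij_is_inj)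

lemma conj_by_id: "bij x \<Longrightarrow> conj_by x id = id"
  by (auto simp: conj_by_def fun_eq_iff bij_is_surj surj_f_inv_f)

lemma conj_by_inverse: "bij x \<Longrightarrow> conj_by (inv' x) (conj_by x p) = p"
  by (auto simp: conj_by_def fun_eq_iff bij_is_inj bij_is_surj surj_f_inv_f inv_inv_eq)

lemma conj_by_inverse': "bij x \<Longrightarrow> conj_by x (conj_by (inv' x) p) = p"
  by (auto simp: conj_by_def fun_eq_iff bij_is_inj bij_is_surj surj_f_inv_f inv_inv_eq)

lemma conj_by_conj_by: "bij x \<Longrightarrow> bij y \<Longrightarrow> conj_by x (conj_by y p) = conj_by (x \<circ> y) p"
  by (simp add: conj_by_def o_inv_distrib comp_assoc)

lemma conj_by_in_alt5:
  assumes "x permutes {1..5}" "p \<in> A5" shows "conj_by x p \<in> A5"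
proof -
  have "permutation x" "permutation p" "p permutes {1..5}" "evenperm p"
    using assms alt_group_carrier'[of p 5] by (auto simp: alt_group_carrier permutation_permutes)
  moreover from this have "permutation (inv' x)"
    by (simp add: permutation_inverse)
  ultimately show ?thesis
    using assms(1) by (auto simp: conj_by_def alt_group_carrier evenperm_comp evenperm_inv
      permutation_compose intro!: permutes_compose permutes_inv)
qed

lemma conj_by_hom:
  assumes "x permutes {1..5}" shows "group_hom Alt5 Alt5 (conj_by x)"
  using assms by (auto intro!: group_hom.intro alt5_group group_hom_axioms.intro homI
      simp: conj_by_in_alt5 conj_by_comp permutes_bij)

lemma conj_by_alt5: 
  assumes "x permutes {1..5}" shows "conj_by x ` A5 = A5"
proof -
  have "p \<in> conj_by x ` A5" if "p \<in> A5" for p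
    using conj_by_inverse'[of x p] conj_by_in_alt5[OF permutes_inv[OF assms] that]
      permutes_bij[OF assms] by force
  then show ?thesis using conj_by_in_alt5[OF assms] by auto
qed

lemma conj_by_funpow: "bij x \<Longrightarrow> conj_by x (p ^^ n) = conj_by x p ^^ n"
  by (induction n) (simp_all add: conj_by_id conj_by_comp)

lemma conj_by_eq_id: "bij x \<Longrightarrow> conj_by x p = id \<longleftrightarrow> p = id"
  by (metis conj_by_id conj_by_inverse)

lemma icosa_generators_standard:
  assumes x: "x permutes {1..5}"
  shows "icosa_generators (conj_by x alpha0) (conj_by x gamma0)"
proof -
  note b = permutes_bij[OF x]
  interpret group_hom Alt5 Alt5 "conj_by x" by (rule conj_by_hom[OF x])
  have "generate Alt5 {conj_by x alpha0, conj_by x gamma0} = A5"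
    using generate_img[of "{alpha0, gamma0}"] alpha0_in gamma0_in
    by (simp add: alt5_generated conj_by_alt5[OF x])
  moreover have "group.ord Alt5 (conj_by x p) = n" if "p \<in> A5" "group.ord Alt5 p = n" "Factorial_Ring.prime n" for p and n :: nat
  proof (rule alt5_ord_prime)
    show "conj_by x p ^^ n = id"
      using alt5_pow_ord[OF that(1)] that(2) conj_by_funpow[OF b, of n p] conj_by_eq_id[OF b] by metis
    show "conj_by x p \<noteq> id"
      using conj_by_eq_id[OF b, of p] group.ord_eq_1[OF alt5_group, of p] that by auto
  qed (use that conj_by_in_alt5[OF x] in auto)
  ultimately show ?thesis
    using gen0_ord alpha0_in gamma0_in alt5_comp
    by (simp add: icosa_generators_def conj_by_in_alt5[OF x] conj_by_comp[OF b, symmetric])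
qed

lemma perm5_permutes:
  assumes "distinct [a, b, c, d, e]" "set [a, b, c, d, e] \<subseteq> {1..5}"
  shows "perm5 a b c d e permutes {1..5}"
proof (rule bij_imp_permutes)
  have eq: "{1..5} = {1, 2, 3, 4, 5::nat}" by auto
  have "inj_on (perm5 a b c d e) {1..5}"
    unfolding eq using assms(1) by (auto simp: inj_on_def)
  moreover have "perm5 a b c d e ` {1..5} \<subseteq> {1..5}"
    using assms(2) unfolding eq by auto
  ultimately show "bij_betw (perm5 a b c d e) {1..5} {1..5}"
    by (simp add: bij_betw_def endo_inj_surj)
qed (rule perm5_outside)

lemma conj_byI: "bij x \<Longrightarrow> p \<circ> x = x \<circ> q \<Longrightarrow> p = conj_by x q"
  by (metis conj_by_def comp_assoc bij_is_surj comp_id surj_iff)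

lemma conj_by_apply: "bij x \<Longrightarrow> conj_by x p (x i) = x (p i)"
  by (simp add: conj_by_def bij_is_inj)

lemma alt5_outside: "p \<in> A5 \<Longrightarrow> i \<notin> {1..5} \<Longrightarrow> p i = i"
  using alt5_permutes permutes_not_in by metis

lemma alt5_closed_set: "p \<in> A5 \<Longrightarrow> p i \<in> {1..5} \<longleftrightarrow> i \<in> {1..5}"
  using alt5_permutes permutes_in_image by metis

text \<open>An involution that moves only two points is a transposition, hence odd. So there are two
  disjoint moved pairs, and the fifth point is fixed.\<close>

lemma alt5_involution_standard:
  assumes a: "\<alpha> \<in> A5" and "group.ord Alt5 \<alpha> = 2"
  obtains x where "x permutes {1..5}" "\<alpha> = conj_by x alpha0"
proof -
  have inv: "\<alpha> (\<alpha> i) = i" for i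
    using alt5_pow_ord[OF a] assms(2) by (simp add: funpow_small fun_eq_iff)
  have "\<alpha> \<noteq> id"
    using assms group.ord_eq_1[OF alt5_group a] by auto
  then obtain p where p: "\<alpha> p \<noteq> p" by (auto simp: fun_eq_iff)
  have "\<exists>q. q \<notin> {p, \<alpha> p} \<and> \<alpha> q \<noteq> q"
  proof (rule ccontr)
    assume "\<not> ?thesis"
    then have "\<alpha> = transpose p (\<alpha> p)"
      by (auto simp: fun_eq_iff transpose_def inv)
    then have "\<not> evenperm \<alpha>"
      using evenperm_swap[of p "\<alpha> p"] p by metis
    then show False using a by (simp add: alt_group_carrier)
  qed
  then obtain q where q: "q \<noteq> p" "q \<noteq> \<alpha> p" "\<alpha> q \<noteq> q" by auto
  have d4: "distinct [p, \<alpha> p, q, \<alpha> q]"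
    using p q inv by auto (metis inv)+
  have in5: "p \<in> {1..5}" "\<alpha> p \<in> {1..5}" "q \<in> {1..5}" "\<alpha> q \<in> {1..5}"
    using p q alt5_outside[OF a] alt5_closed_set[OF a] by metis+
  have "card {p, \<alpha> p, q, \<alpha> q} = 4"
    using d4 by simp
  then have "card ({1..5} - {p, \<alpha> p, q, \<alpha> q}) = 1"
    using in5 by (subst card_Diff_subset) auto
  then obtain r where r: "{1..5} - {p, \<alpha> p, q, \<alpha> q} = {r}"
    by (metis card_1_singletonE)
  then have r': "r \<in> {1..5}" "r \<notin> {p, \<alpha> p, q, \<alpha> q}" by blast+
  have "\<alpha> r \<in> {1..5} - {p, \<alpha> p, q, \<alpha> q}"
    using r' alt5_closed_set[OF a, of r] inv by (auto; metis inv)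
  then have ar: "\<alpha> r = r" unfolding r by blast
  let ?x = "perm5 p (\<alpha> p) q (\<alpha> q) r"
  have x: "?x permutes {1..5}"
    by (rule perm5_permutes) (use d4 in5 r' in auto)
  moreover have "\<alpha> = conj_by ?x alpha0"
  proof (rule conj_byI[OF permutes_bij[OF x]])
    show "\<alpha> \<circ> ?x = ?x \<circ> alpha0"
      by (subst perm5_comp_any[of \<alpha>, OF alt5_outside[OF a]]) (simp_all add: alpha0_def inv ar)
  qed
  ultimately show ?thesis using that by blast
qed

text \<open>The product \<open>alpha0 \<circ> gamma0\<close> is the 5-cycle \<open>(1 4 3 5 2)\<close>, which dictates the labelling.\<close>

lemma five_cycle_standard:
  assumes "c \<in> five_cycles"
  obtains y where "y permutes {1..5}" "c = conj_by y (alpha0 \<circ> gamma0)"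
proof -
  obtain cs where cs: "c = cycle_of_list cs" "cycle cs" "length cs = 5" "set cs \<subseteq> {1..5}"
    using assms by auto
  obtain i j k l m where l: "cs = [i, j, k, l, m]"
    using cs(3) by (auto simp: eval_nat_numeral length_Suc_conv)
  have d: "distinct [i, j, k, l, m]" using cs(2) by (simp add: l)
  let ?y = "perm5 i m k j l"
  have y: "?y permutes {1..5}"
    by (rule perm5_permutes) (use d cs(4) l in auto)
  have out: "n \<notin> {1..5} \<Longrightarrow> c n = n" for n
    unfolding cs(1) using cs(4) id_outside_supp by (metis subsetD)
  have "c i = j" "c j = k" "c k = l" "c l = m" "c m = i"
    using d by (auto simp: cs(1) l transpose_def)
  then have "c \<circ> ?y = ?y \<circ> (alpha0 \<circ> gamma0)"
    by (subst perm5_comp_any[of c]) (simp_all add: out gen0_defs)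
  then show ?thesis
    using conj_byI[OF permutes_bij[OF y]] y that by blast
qed

text \<open>Relabelling \<open>\<alpha>\<close> to the standard involution turns the standard 5-cycle into a conjugate
  of \<open>c\<close>, but perhaps by an odd permutation. The transposition \<open>(1 2)\<close> centralizes the standard
  involution and corrects the parity, so both classes of 5-cycles are reached.\<close>

lemma icosa_generators_exist:
  assumes "\<alpha> \<in> A5" "group.ord Alt5 \<alpha> = 2" "c \<in> five_cycles"
  shows "\<exists>\<gamma>. icosa_generators \<alpha> \<gamma> \<and> \<alpha> \<circ> \<gamma> \<in> conj_class Alt5 c"
proof -
  obtain x where x: "x permutes {1..5}" "\<alpha> = conj_by x alpha0"
    using alt5_involution_standard[OF assms(1,2)] .
  obtain y where y: "y permutes {1..5}" "c = conj_by y (alpha0 \<circ> gamma0)"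
    using five_cycle_standard[OF assms(3)] .
  have *: ?thesis
    if z: "z permutes {1..5}" "\<alpha> = conj_by z alpha0" "evenperm (z \<circ> inv' y)" for z
  proof -
    note bz = permutes_bij[OF z(1)] and by' = permutes_bij[OF y(1)]
    let ?h = "z \<circ> inv' y"
    have h: "?h \<in> A5"
      using z y by (auto simp: alt_group_carrier intro!: permutes_compose permutes_inv)
    have "conj_by z (alpha0 \<circ> gamma0) = ?h \<circ> c \<circ> inv' ?h"
    proof -
      have "bij ?h" using bz by' by (simp add: bij_comp bij_imp_bij_inv)
      moreover have "?h \<circ> y = z" using by' by (simp add: comp_assoc bij_is_inj)
      ultimately show ?thesis
        using conj_by_conj_by[of ?h y "alpha0 \<circ> gamma0"] by' y(2) by (metis conj_by_def)
    qed
    then have "conj_by z (alpha0 \<circ> gamma0) \<in> conj_class Alt5 c"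
      using h alt5_m_inv[OF h] unfolding conj_class_def by force
    then show ?thesis
      using icosa_generators_standard[OF z(1)] z(2) conj_by_comp[OF bz, of alpha0 gamma0] by auto
  qed
  show ?thesis
  proof (cases "evenperm (x \<circ> inv' y)")
    case True
    then show ?thesis using * x by blast
  next
    case False
    let ?t = "transpose 1 (2::nat)"
    have t: "?t permutes {1..5}" by (rule permutes_swap_id) auto
    have fin: "permutation x" "permutation (inv' y)" "permutation ?t"
      using x(1) permutes_inv[OF y(1)] t unfolding permutation_permutes by blast+
    have "?t \<circ> alpha0 = alpha0 \<circ> ?t"
      by (auto simp: alpha0_transp transpose_def fun_eq_iff)
    then have "conj_by (x \<circ> ?t) alpha0 = \<alpha>"
      using conj_by_conj_by[of x ?t alpha0] x conj_byI[of ?t alpha0 alpha0] permutes_bij[OF t]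
        permutes_bij[OF x(1)] by metis
    moreover have "evenperm (x \<circ> ?t \<circ> inv' y)"
      using False fin by (simp add: evenperm_comp permutation_compose evenperm_swap)
    ultimately show ?thesis
      using * permutes_compose[OF t x(1)] by metis
  qed
qed

text \<open>Let \<open>r\<close> be the point fixed by \<open>\<alpha>\<close>. The group is transitive, so \<open>\<gamma>\<close> moves \<open>r\<close>, say in
  the cycle \<open>(r p q)\<close>. The points \<open>p\<close> and \<open>q\<close> lie in different orbits of \<open>\<alpha>\<close>, for otherwise
  \<open>\<alpha> \<circ> \<gamma>\<close> would swap \<open>r\<close> and \<open>q\<close>. The labels are then forced: \<open>p\<close>, \<open>\<alpha> p\<close>, \<open>q\<close>,
  \<open>\<alpha> q\<close>, \<open>r\<close>.\<close>

lemma icosa_generators_conj_standard: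
  assumes "icosa_generators \<alpha> \<gamma>"
  obtains x where "x permutes {1..5}" "\<alpha> = conj_by x alpha0" "\<gamma> = conj_by x gamma0"
proof -
  have a: "\<alpha> \<in> A5" "group.ord Alt5 \<alpha> = 2" and g: "\<gamma> \<in> A5" "group.ord Alt5 \<gamma> = 3"
    and gen: "generate Alt5 {\<alpha>, \<gamma>} = A5" and ag: "group.ord Alt5 (\<alpha> \<circ> \<gamma>) = 5"
    using assms by (auto simp: icosa_generators_def)
  obtain w where w: "w permutes {1..5}" "\<alpha> = conj_by w alpha0"
    using alt5_involution_standard[OF a] .
  note bw = permutes_bij[OF w(1)]
  define r where "r = w 5"
  have r5: "r \<in> {1..5}" using w(1) permutes_in_image[OF w(1), of 5] by (simp add: r_def)
  have aw: "\<alpha> (w 1) = w 2" "\<alpha> (w 2) = w 1" "\<alpha> (w 3) = w 4" "\<alpha> (w 4) = w 3" "\<alpha> (w 5) = w 5"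
    unfolding w(2) conj_by_apply[OF bw] by (simp_all add: alpha0_def)
  have afix: "\<alpha> i = i \<longleftrightarrow> i = r" if "i \<in> {1..5}" for i
  proof -
    have "i \<in> w ` {1..5}"
      using that by (simp only: permutes_image[OF w(1)])
    then obtain j where "j \<in> {1..5}" "i = w j" by blast
    then show ?thesis
      using aw bij_is_inj[OF bw] by (elim cases5[of j]) (auto simp: r_def inj_eq)
  qed
  have inv: "\<alpha> (\<alpha> i) = i" for i
    using alt5_pow_ord[OF a(1)] a(2) by (simp add: funpow_small fun_eq_iff)
  have g3: "\<gamma> (\<gamma> (\<gamma> i)) = i" for i
    using alt5_pow_ord[OF g(1)] g(2) by (simp add: funpow_small fun_eq_iff)
  have c5: "\<alpha> (\<gamma> (\<alpha> (\<gamma> (\<alpha> (\<gamma> (\<alpha> (\<gamma> (\<alpha> (\<gamma> i))))))))) = i" for i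
    using alt5_pow_ord[OF alt5_comp[OF a(1) g(1)]] ag by (simp add: funpow_small fun_eq_iff)
  have "\<gamma> r \<noteq> r"
  proof
    assume "\<gamma> r = r"
    have "p r = r" if "p \<in> generate Alt5 {\<alpha>, \<gamma>}" for p
      using that
    proof induction
      case one then show ?case by simp
    next
      case (incl h) then show ?case using aw \<open>\<gamma> r = r\<close> by (auto simp: r_def)
    next
      case (inv h)
      then have "h \<in> A5" "h r = r" using a g aw \<open>\<gamma> r = r\<close> by (auto simp: r_def)
      then show ?case using alt5_bij[of h] by (simp add: alt5_m_inv bij_is_inj inv_f_eq)
    next
      case (eng h1 h2) then show ?case by simp
    qed
    then have "conj_by w gamma0 r = r"
      using conj_by_in_alt5[OF w(1) gamma0_in] gen by blast
    then show False
      using conj_by_apply[OF bw, of gamma0 5] bij_is_inj[OF bw] by (simp add: r_def gamma0_def inj_eq)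
  qed
  define p where "p = \<gamma> r"
  define q where "q = \<gamma> p"
  have gq: "\<gamma> q = r" by (simp add: p_def q_def g3)
  have pr: "p \<noteq> r" using \<open>\<gamma> r \<noteq> r\<close> by (simp add: p_def)
  have qp: "q \<noteq> p" "q \<noteq> r" using pr gq g3 by (metis p_def q_def)+
  have in5: "p \<in> {1..5}" "q \<in> {1..5}" "\<alpha> p \<in> {1..5}" "\<alpha> q \<in> {1..5}"
    using r5 alt5_closed_set[OF g(1)] alt5_closed_set[OF a(1)] by (simp_all add: p_def q_def)
  have apq: "\<alpha> p \<noteq> p" "\<alpha> q \<noteq> q" "\<alpha> p \<noteq> r" "\<alpha> q \<noteq> r"
    using afix in5 pr qp r5 inv by metis+
  have "\<alpha> p \<noteq> q"
  proof
    assume "\<alpha> p = q"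
    then have *: "\<alpha> (\<gamma> r) = q" "\<alpha> (\<gamma> q) = r"
      using gq afix[OF r5] by (simp_all add: p_def)
    then show False
      using c5[of r] qp by simp
  qed
  then have apq': "\<alpha> p \<noteq> q" "\<alpha> q \<noteq> p" using inv by metis+
  have apaq: "\<alpha> p \<noteq> \<alpha> q" using qp inv by metis
  let ?x = "perm5 p (\<alpha> p) q (\<alpha> q) r"
  have d: "distinct [p, \<alpha> p, q, \<alpha> q, r]"
    using pr qp apq apq' apaq by auto
  have x: "?x permutes {1..5}"
    by (rule perm5_permutes) (use d in5 r5 in auto)
  have five: "{1..5} = {p, \<alpha> p, q, \<alpha> q, r}"
    by (rule card_subset_eq[symmetric]) (use d in5 r5 in auto)
  have fixed: "\<gamma> s = s" if s: "s = \<alpha> p \<or> s = \<alpha> q" for s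
  proof -
    have inj: "inj \<gamma>" using alt5_bij[OF g(1)] bij_is_inj by blast
    have step: "\<gamma> s \<in> {\<alpha> p, \<alpha> q}" if "s \<in> {\<alpha> p, \<alpha> q}" for s
    proof -
      have "s \<in> {1..5}" using that in5 by auto
      then have "\<gamma> s \<in> {1..5}" using alt5_closed_set[OF g(1)] by blast
      moreover have "s \<noteq> r" "s \<noteq> p" "s \<noteq> q"
        using that d by auto
      then have "\<gamma> s \<noteq> \<gamma> r" "\<gamma> s \<noteq> \<gamma> p" "\<gamma> s \<noteq> \<gamma> q"
        using inj by (simp_all only: inj_eq) auto
      then have "\<gamma> s \<noteq> p" "\<gamma> s \<noteq> q" "\<gamma> s \<noteq> r"
        by (simp_all only: gq p_def[symmetric] q_def[symmetric]) auto
      ultimately show ?thesis unfolding five by blast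
    qed
    show ?thesis
      using step[of "\<alpha> p"] step[of "\<alpha> q"] s g3[of "\<alpha> p"] g3[of "\<alpha> q"] by auto
  qed
  have "\<alpha> = conj_by ?x alpha0"
    by (rule conj_byI[OF permutes_bij[OF x]])
      (subst perm5_comp_any[of \<alpha>, OF alt5_outside[OF a(1)]],
        use inv afix[OF r5] in \<open>simp_all add: alpha0_def\<close>)
  moreover have "\<gamma> = conj_by ?x gamma0"
    by (rule conj_byI[OF permutes_bij[OF x]])
      (subst perm5_comp_any[of \<gamma>, OF alt5_outside[OF g(1)]],
        use fixed gq in \<open>simp_all add: gamma0_def p_def[symmetric] q_def[symmetric]\<close>)
  ultimately show ?thesis using x that by blast
qed

text \<open>The generators have finite order, so their inverses are products of generators and
  induction over positive words suffices.\<close>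

lemma icosa_generators_induct [consumes 2, case_names id alpha gamma]:
  assumes gens: "icosa_generators \<alpha> \<gamma>" and h: "h \<in> A5"
    and id: "P id"
    and alpha: "\<And>h. h \<in> A5 \<Longrightarrow> P h \<Longrightarrow> P (\<alpha> \<circ> h)"
    and gamma: "\<And>h. h \<in> A5 \<Longrightarrow> P h \<Longrightarrow> P (\<gamma> \<circ> h)"
  shows "P h"
proof -
  have a: "\<alpha> \<in> A5" "group.ord Alt5 \<alpha> = 2" and g: "\<gamma> \<in> A5" "group.ord Alt5 \<gamma> = 3"
    and gen: "generate Alt5 {\<alpha>, \<gamma>} = A5"
    using gens by (auto simp: icosa_generators_def)
  have ia: "inv' \<alpha> = \<alpha>"
    using alt5_pow_ord[OF a(1)] a(2) by (intro inv_unique_comp) (simp_all add: funpow_small)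
  have ig: "inv' \<gamma> = \<gamma> \<circ> \<gamma>"
    using alt5_pow_ord[OF g(1)] g(2) by (intro inv_unique_comp) (simp_all add: funpow_small comp_assoc)
  have "p \<in> A5 \<and> (\<forall>k \<in> A5. P k \<longrightarrow> P (p \<circ> k))" if "p \<in> generate Alt5 {\<alpha>, \<gamma>}" for p
    using that
  proof induction
    case one then show ?case using alt5_id by (simp only: alt5_one id_comp) blast
  next
    case (incl h) then show ?case using a(1) g(1) alpha gamma by blast
  next
    case (inv h) 
    then consider "h = \<alpha>" | "h = \<gamma>" by blast
    then show ?case
    proof cases
      case 1
      then have "inv\<^bsub>Alt5\<^esub> h = \<alpha>" using a by (simp add: alt5_m_inv ia)
      then show ?thesis using a(1) alpha by metis
    next
      case 2
      then have "inv\<^bsub>Alt5\<^esub> h = \<gamma> \<circ> \<gamma>" using g by (simp add: alt5_m_inv ig)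
      moreover have "P (\<gamma> \<circ> \<gamma> \<circ> k)" if "k \<in> A5" "P k" for k
        unfolding comp_assoc by (intro gamma alt5_comp g that)
      ultimately show ?thesis using alt5_comp[OF g(1) g(1)] by (simp only:) blast
    qed
  next
    case (eng h1 h2) then show ?case
      using alt5_comp by (simp only: alt5_mult comp_assoc) blast
  qed
  from this[of h] have "P (h \<circ> id)" using h id alt5_id gen by blast
  then show ?thesis by simp
qed

section \<open>The twelve vertices of the icosahedron\<close>

lemma conj_class_alt5: "conj_class Alt5 c = {conj_by h c | h. h \<in> A5}"
  by (force simp: conj_class_def conj_by_def alt5_m_inv)

lemma conj_class_eq:
  assumes "c' \<in> conj_class Alt5 c" shows "conj_class Alt5 c' = conj_class Alt5 c"
proof -
  obtain h where h: "h \<in> A5" "c' = conj_by h c"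
    using assms by (auto simp: conj_class_alt5)
  have "conj_by k c' = conj_by (k \<circ> h) c" if "k \<in> A5" for k
    using that h by (simp add: conj_by_conj_by alt5_bij)
  moreover have "conj_by k c = conj_by (k \<circ> inv' h) c'" if "k \<in> A5" for k
    using that h by (simp add: conj_by_conj_by alt5_bij bij_comp bij_imp_bij_inv comp_assoc bij_is_inj)
  ultimately show ?thesis
    using h alt5_comp alt5_inv unfolding conj_class_alt5 by blast
qed

lemma conj_by_conj_by_distrib:
  assumes "x permutes {1..5}" "h \<in> A5"
  shows "conj_by (conj_by x h) (conj_by x c) = conj_by x (conj_by h c)"
proof -
  note b = permutes_bij[OF assms(1)]
  have "bij (conj_by x h)" using alt5_bij conj_by_in_alt5[OF assms] by blast
  moreover have "conj_by x h \<circ> x = x \<circ> h" using b by (simp add: conj_by_def comp_assoc bij_is_inj)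
  ultimately show ?thesis using b alt5_bij[OF assms(2)] by (simp add: conj_by_conj_by)
qed

lemma conj_class_conj_by:
  assumes "x permutes {1..5}"
  shows "conj_class Alt5 (conj_by x c) = conj_by x ` conj_class Alt5 c"
proof -
  have "conj_class Alt5 (conj_by x c) = {conj_by (conj_by x h) (conj_by x c) | h. h \<in> A5}"
    using conj_by_alt5[OF assms] conj_by_in_alt5[OF assms] unfolding conj_class_alt5
    by (auto simp del: One_nat_def; metis image_iff)
  also have "\<dots> = {conj_by x (conj_by h c) | h. h \<in> A5}"
    using conj_by_conj_by_distrib[OF assms] by metis
  finally show ?thesis unfolding conj_class_alt5 by blast
qed

text \<open>The conjugacy class of \<open>alpha0 \<circ> gamma0\<close>. A 5-cycle in it is a rotation through a fixed
  angle about a vertex of the icosahedron, so the class is the set of vertices with the group acting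
  by conjugation.\<close>

definition vertices0 :: "(nat \<Rightarrow> nat) set" where
  "vertices0 = {perm5 4 1 5 3 2, perm5 2 3 4 5 1, perm5 3 5 2 1 4, perm5 5 4 2 1 3,
     perm5 5 4 1 3 2, perm5 2 4 1 5 3, perm5 3 5 4 2 1, perm5 3 1 5 2 4,
     perm5 4 3 5 2 1, perm5 4 3 1 5 2, perm5 2 5 4 1 3, perm5 5 1 2 3 4}"

lemma inv_gen0: "inv' alpha0 = alpha0" "inv' gamma0 = gamma0 \<circ> gamma0"
  by (rule inv_unique_comp; simp add: gen0_defs id_eq_perm5)+

lemma conj_gen0_vertices0:
  "p \<in> vertices0 \<Longrightarrow> conj_by alpha0 p \<in> vertices0"
  "p \<in> vertices0 \<Longrightarrow> conj_by gamma0 p \<in> vertices0"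
  unfolding vertices0_def conj_by_def inv_gen0 unfolding gen0_defs
  by (elim insertE emptyE; simp)+

lemma alpha0_gamma0_generators: "icosa_generators alpha0 gamma0"
  using icosa_generators_standard[OF permutes_id[of "{1..5}"]] by (simp add: conj_by_def)

text \<open>The list is closed under conjugation by both generators, and starting from \<open>alpha0 \<circ> gamma0\<close>
  these conjugations reach every entry.\<close>

lemma conj_class0: "conj_class Alt5 (alpha0 \<circ> gamma0) = vertices0"
proof (intro equalityI subsetI)
  fix p assume "p \<in> conj_class Alt5 (alpha0 \<circ> gamma0)"
  then obtain h where h: "h \<in> A5" "p = conj_by h (alpha0 \<circ> gamma0)"
    by (auto simp: conj_class_alt5)
  have "conj_by h (alpha0 \<circ> gamma0) \<in> vertices0"
    using alpha0_gamma0_generators h(1)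
  proof (induction rule: icosa_generators_induct)
    case id then show ?case by (simp add: conj_by_def vertices0_def gen0_defs)
  next
    case (alpha h)
    then show ?case
      using conj_gen0_vertices0(1) by (metis conj_by_conj_by alt5_bij alpha0_in)
  next
    case (gamma h)
    then show ?case
      using conj_gen0_vertices0(2) by (metis conj_by_conj_by alt5_bij gamma0_in)
  qed
  then show "p \<in> vertices0" using h by simp
next
  let ?C = "conj_class Alt5 (alpha0 \<circ> gamma0)"
  have 0: "perm5 4 1 5 3 2 \<in> ?C"
    using alt5_id conj_by_id by (force simp: conj_class_alt5 gen0_defs conj_by_def)
  have step: "alpha0 \<circ> p \<circ> alpha0 \<in> ?C" "gamma0 \<circ> p \<circ> (gamma0 \<circ> gamma0) \<in> ?C" if p: "p \<in> ?C" for p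
  proof -
    have "conj_by k p \<in> ?C" if "k \<in> A5" for k
    proof -
      obtain h where "h \<in> A5" "p = conj_by h (alpha0 \<circ> gamma0)"
        using p by (auto simp: conj_class_alt5)
      then have "conj_by k p = conj_by (k \<circ> h) (alpha0 \<circ> gamma0)" "k \<circ> h \<in> A5"
        using that by (simp_all add: conj_by_conj_by alt5_bij alt5_comp)
      then show ?thesis unfolding conj_class_alt5 by blast
    qed
    from this[OF alpha0_in] this[OF gamma0_in]
    show "alpha0 \<circ> p \<circ> alpha0 \<in> ?C" "gamma0 \<circ> p \<circ> (gamma0 \<circ> gamma0) \<in> ?C"
      by (simp_all add: conj_by_def inv_gen0)
  qed
  show "p \<in> ?C" if "p \<in> vertices0" for p
  proof -
    have a: "perm5 2 1 4 3 5 \<circ> p \<circ> perm5 2 1 4 3 5 \<in> ?C" if "p \<in> ?C" for p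
      using step(1)[OF that] by (simp add: gen0_defs)
    have g: "perm5 3 2 5 4 1 \<circ> p \<circ> perm5 5 2 1 4 3 \<in> ?C" if "p \<in> ?C" for p
      using step(2)[OF that] by (simp add: gen0_defs)
    note 1 = a[OF 0, simplified]
    note 2 = g[OF 1, simplified]
    note 3 = a[OF 2, simplified]
    note 4 = g[OF 3, simplified]
    note 5 = a[OF 4, simplified]
    note 6 = g[OF 4, simplified]
    note 7 = g[OF 5, simplified]
    note 8 = g[OF 7, simplified]
    note 9 = a[OF 8, simplified]
    note 10 = g[OF 9, simplified]
    note 11 = a[OF 10, simplified]
    show ?thesis
      using that 0 1 2 3 4 5 6 7 8 9 10 11 unfolding vertices0_def by auto
  qed
qed

lemma vertices0_subset: "vertices0 \<subseteq> A5"
  using conj_by_in_alt5[OF alt5_permutes] alt5_comp[OF alpha0_in gamma0_in]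
  unfolding conj_class0[symmetric] conj_class_alt5 by blast

section \<open>Axes of commuting involutions\<close>

lemma add_group_simps [simp]:
  "carrier (add_group :: 'v::ab_group_add monoid) = UNIV"
  "x \<otimes>\<^bsub>add_group\<^esub> y = x + (y::'v::ab_group_add)"
  "\<one>\<^bsub>add_group\<^esub> = (0::'v::ab_group_add)"
  by (simp_all add: add_group_def)

lemma comm_group_add_group: "comm_group (add_group :: 'v::ab_group_add monoid)"
  by (rule comm_groupI) (auto simp: add.assoc add.commute intro: exI[of _ "- _"] left_minus)

lemma inv_add_group [simp]: "inv\<^bsub>add_group\<^esub> x = - (x::'v::ab_group_add)"
  by (rule group.inv_equality) (simp_all add: comm_group.axioms(2) comm_group_add_group)

lemma gmoduleI:
  assumes "group G" "comm_group V" and UNIV: "carrier V = UNIV"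
    and add: "\<And>g v w. g \<in> carrier G \<Longrightarrow> act g (v \<otimes>\<^bsub>V\<^esub> w) = act g v \<otimes>\<^bsub>V\<^esub> act g w"
    and mult: "\<And>g h v. g \<in> carrier G \<Longrightarrow> h \<in> carrier G \<Longrightarrow> act (g \<otimes>\<^bsub>G\<^esub> h) v = act g (act h v)"
    and one: "\<And>v. act \<one>\<^bsub>G\<^esub> v = v"
  shows "gmodule G V act"
proof -
  interpret group G by fact
  have bij: "bij (act g)" if "g \<in> carrier G" for g
    using that mult[of g "inv\<^bsub>G\<^esub> g"] mult[of "inv\<^bsub>G\<^esub> g" g] one
    by (intro o_bij[of "act (inv\<^bsub>G\<^esub> g)"]) (auto simp: fun_eq_iff)
  have auto: "act g \<in> auto V" "act g \<in> Bij (carrier V)" if "g \<in> carrier G" for g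
    using that bij add by (auto simp: auto_def hom_def Bij_def UNIV)
  show ?thesis
    using assms(1,2) auto mult
    by (auto simp: gmodule_def hom_def AutoGroup_def BijGroup_def compose_def UNIV)
qed

lemma gmoduleD:
  assumes "gmodule G V act" "carrier V = UNIV"
  shows "g \<in> carrier G \<Longrightarrow> act g (v \<otimes>\<^bsub>V\<^esub> w) = act g v \<otimes>\<^bsub>V\<^esub> act g w"
    and "g \<in> carrier G \<Longrightarrow> h \<in> carrier G \<Longrightarrow> act (g \<otimes>\<^bsub>G\<^esub> h) v = act g (act h v)"
    and "act \<one>\<^bsub>G\<^esub> v = v"
proof -
  interpret group G using assms by (simp add: gmodule_def)
  have auto: "act g \<in> auto V" if "g \<in> carrier G" for g
    using assms that by (auto simp: gmodule_def hom_def AutoGroup_def)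
  show "g \<in> carrier G \<Longrightarrow> act g (v \<otimes>\<^bsub>V\<^esub> w) = act g v \<otimes>\<^bsub>V\<^esub> act g w"
    using auto[of g] assms(2) by (auto simp: auto_def hom_def)
  show mult: "g \<in> carrier G \<Longrightarrow> h \<in> carrier G \<Longrightarrow> act (g \<otimes>\<^bsub>G\<^esub> h) v = act g (act h v)" for g h v
    using assms auto[of g] auto[of h]
    by (auto simp: gmodule_def hom_def AutoGroup_def BijGroup_def auto_def compose_def)
  have "inj (act \<one>\<^bsub>G\<^esub>)"
    using auto[of "\<one>\<^bsub>G\<^esub>"] assms(2) by (auto simp: auto_def Bij_def bij_betw_def)
  then show "act \<one>\<^bsub>G\<^esub> v = v"
    using mult[of "\<one>\<^bsub>G\<^esub>" "\<one>\<^bsub>G\<^esub>" v] by (simp add: inj_eq)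
qed

locale additive_gmodule = group G for G :: "('g, 'x) monoid_scheme" (structure) +
  fixes act :: "'g \<Rightarrow> 'v::ab_group_add \<Rightarrow> 'v"
  assumes gmodule_act: "gmodule G (add_group :: 'v monoid) act"
begin

lemma act_add: "g \<in> carrier G \<Longrightarrow> act g (v + w) = act g v + act g w"
  using gmoduleD(1)[OF gmodule_act] by simp

lemma act_mult: "g \<in> carrier G \<Longrightarrow> h \<in> carrier G \<Longrightarrow> act (g \<otimes> h) v = act g (act h v)"
  using gmoduleD(2)[OF gmodule_act] by simp

lemma act_one: "act \<one> v = v"
  using gmoduleD(3)[OF gmodule_act] by simp

lemma act_zero: "g \<in> carrier G \<Longrightarrow> act g 0 = 0"
  using act_add[of g 0 0] by simp

lemma act_minus: "g \<in> carrier G \<Longrightarrow> act g (- v) = - act g v"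
  using act_add[of g v "- v"] by (simp add: act_zero eq_neg_iff_add_eq_0 add.commute)

lemma act_diff: "g \<in> carrier G \<Longrightarrow> act g (v - w) = act g v - act g w"
  using act_add[of g v "- w"] by (simp add: act_minus)

lemma act_sum: "g \<in> carrier G \<Longrightarrow> act g (\<Sum>i\<in>I. f i) = (\<Sum>i\<in>I. act g (f i))"
  by (induction I rule: infinite_finite_induct) (simp_all add: act_zero act_add)

lemma act_inv_act: "g \<in> carrier G \<Longrightarrow> act (inv g) (act g v) = v"
  using act_mult[of "inv g" g v] by (simp add: act_one)

lemma setwise_normalizer_subgroup: "subgroup (setwise_normalizer G act A) G"
proof (rule subgroupI)
  fix g assume g: "g \<in> setwise_normalizer G act A"
  then have "g \<in> carrier G" by (simp add: setwise_normalizer_def)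
  then have "act (inv g) ` (act g ` A) = A"
    by (simp only: image_image act_inv_act image_ident)
  then show "inv g \<in> setwise_normalizer G act A"
    using g by (simp add: setwise_normalizer_def)
next
  fix g h assume gh: "g \<in> setwise_normalizer G act A" "h \<in> setwise_normalizer G act A"
  then have "g \<in> carrier G" "h \<in> carrier G" by (simp_all add: setwise_normalizer_def)
  then have "act (g \<otimes> h) ` A = act g ` (act h ` A)"
    by (simp add: image_image act_mult)
  then show "g \<otimes> h \<in> setwise_normalizer G act A"
    using gh by (simp add: setwise_normalizer_def)
qed (auto simp: setwise_normalizer_def act_one intro: exI[of _ \<one>])

text \<open>If \<open>\<beta>\<close> does not invert the axis of \<open>\<alpha>\<close>, the two axes agree and \<open>\<sigma>\<close> preserves the
  common axis. An element of order three cannot act on it as \<open>-1\<close>, so \<open>\<sigma>\<close> centralizes it and has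
  the same axis. Now \<open>\<tau>\<close>, which inverts \<open>\<sigma>\<close>, preserves the axis of \<open>\<sigma>\<close>. Hence a
  generating set preserves the axis of \<open>\<alpha>\<close>.\<close>

lemma commuting_involution_inverts_axis:
  assumes rot: "rotation_module_3D G act A"
    and nonaxial: "\<not> axial G act A"
    and no_2_torsion: "\<And>v::'v. v + v = 0 \<Longrightarrow> v = 0"
    and elems: "\<alpha> \<in> carrier G" "\<beta> \<in> carrier G" "\<sigma> \<in> carrier G" "\<tau> \<in> carrier G"
      "\<alpha> \<noteq> \<one>" "\<beta> \<noteq> \<one>" "\<sigma> \<noteq> \<one>" "\<tau> \<noteq> \<one>"
    and comm: "\<beta> \<otimes> \<alpha> \<otimes> inv \<beta> = \<alpha>"
    and conj: "\<sigma> \<otimes> \<alpha> \<otimes> inv \<sigma> = \<beta>"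
    and order3: "\<sigma> \<otimes> \<sigma> \<otimes> \<sigma> = \<one>"
    and inverse: "\<tau> \<otimes> \<sigma> \<otimes> inv \<tau> = inv \<sigma>"
    and gen: "generate G {\<alpha>, \<beta>, \<tau>} = carrier G"
    and a: "a \<in> A \<alpha>"
  shows "act \<beta> a = - a"
proof (rule ccontr)
  assume "act \<beta> a \<noteq> - a"
  let ?G = "carrier G - {\<one>}"
  have axis_conj: "act h ` A g = A (h \<otimes> g \<otimes> inv h)" if "g \<in> ?G" "h \<in> ?G" for g h
    using rot that by (auto simp: rotation_module_3D_def)
  have centralizes: "h \<in> pointwise_centralizer G act (A g) \<longleftrightarrow> A h = A g" if "g \<in> ?G" "h \<in> ?G" for g h
    using rot that unfolding rotation_module_3D_def by blast
  have inverts: "act h b = - b"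
    if "g \<in> ?G" "h \<in> ?G" "act h ` A g = A g" "A h \<noteq> A g" "b \<in> A g" for g h b
    using rot that centralizes[OF that(1,2)]
    unfolding rotation_module_3D_def setwise_normalizer_def by blast
  have el: "\<alpha> \<in> ?G" "\<beta> \<in> ?G" "\<sigma> \<in> ?G" "\<tau> \<in> ?G" "inv \<sigma> \<in> ?G"
    using elems by auto
  have "act \<beta> ` A \<alpha> = A \<alpha>"
    using axis_conj[OF el(1,2)] comm by simp
  then have AB: "A \<beta> = A \<alpha>"
    using inverts[OF el(1,2) _ _ a] \<open>act \<beta> a \<noteq> - a\<close> by blast
  have \<sigma>A: "act \<sigma> ` A \<alpha> = A \<alpha>"
    using axis_conj[OF el(1,3)] conj AB by simp
  have AS: "A \<sigma> = A \<alpha>"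
  proof (rule ccontr)
    assume ne: "A \<sigma> \<noteq> A \<alpha>"
    have "b = 0" if b: "b \<in> A \<alpha>" for b
    proof -
      have inv: "act \<sigma> c = - c" if "c \<in> A \<alpha>" for c
        using inverts[OF el(1,3) \<sigma>A ne that] .
      have "act (\<sigma> \<otimes> \<sigma> \<otimes> \<sigma>) b = - b"
        using elems inv[OF b] by (simp add: act_mult act_minus)
      then have "b = - b"
        using order3 by (simp add: act_one)
      then have "b + b = 0"
        by (simp only: eq_neg_iff_add_eq_0)
      then show "b = 0" by (rule no_2_torsion)
    qed
    moreover have "A \<alpha> \<noteq> {0}" "0 \<in> A \<alpha>"
      using rot el subgroup.one_closed[of "A \<alpha>" add_group]
      by (auto simp: rotation_module_3D_def)
    ultimately show False by blast
  qed
  have "inv \<sigma> \<in> pointwise_centralizer G act (A \<sigma>)"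
  proof -
    have "\<sigma> \<in> pointwise_centralizer G act (A \<sigma>)"
      using centralizes[OF el(3,3)] by simp
    then show ?thesis
      using elems unfolding pointwise_centralizer_def by (auto; metis act_inv_act)
  qed
  then have "A (inv \<sigma>) = A \<sigma>"
    using centralizes[OF el(3,5)] by simp
  then have "act \<tau> ` A \<alpha> = A \<alpha>"
    using axis_conj[OF el(3,4)] inverse AS by simp
  moreover have "act \<alpha> ` A \<alpha> = A \<alpha>"
    using axis_conj[OF el(1,1)] elems by (simp add: m_assoc)
  ultimately have "{\<alpha>, \<beta>, \<tau>} \<subseteq> setwise_normalizer G act (A \<alpha>)"
    using \<open>act \<beta> ` A \<alpha> = A \<alpha>\<close> elems by (auto simp: setwise_normalizer_def)
  then have "carrier G \<subseteq> setwise_normalizer G act (A \<alpha>)"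
    using generate_subgroup_incl[OF _ setwise_normalizer_subgroup] gen by blast
  then have "axial G act A"
    using el by (auto simp: axial_def setwise_normalizer_def)
  then show False using nonaxial by blast
qed

end

section \<open>The golden endomorphism of an axis\<close>

text \<open>The conjugates by \<open>\<gamma>\<close> of two involutions of the Klein four-group \<open>K = {1, \<alpha>, \<beta>, \<beta>\<alpha>}\<close>.
  Together with \<open>\<gamma>\<close> they represent the three double cosets of \<open>K\<close> outside its normalizer; the
  following lemmas locate the elements that occur below in these double cosets.\<close>

definition "delta0 = gamma0 \<circ> alpha0 \<circ> (gamma0 \<circ> gamma0)"
definition "epsilon0 = gamma0 \<circ> (beta0 \<circ> alpha0) \<circ> (gamma0 \<circ> gamma0)"

lemma delta0_in: "delta0 \<in> A5" and epsilon0_in: "epsilon0 \<in> A5"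
  unfolding delta0_def epsilon0_def by (intro alt5_comp alpha0_in beta0_in gamma0_in)+

lemmas word0_defs = delta0_def epsilon0_def gen0_defs

lemma vertices0_words:
  "perm5 4 1 5 3 2 = alpha0 \<circ> gamma0"
  "perm5 2 3 4 5 1 = gamma0 \<circ> alpha0"
  "perm5 3 5 2 1 4 = beta0 \<circ> epsilon0"
  "perm5 5 4 2 1 3 = alpha0 \<circ> (beta0 \<circ> (epsilon0 \<circ> alpha0))"
  "perm5 5 4 1 3 2 = beta0 \<circ> (delta0 \<circ> beta0 \<circ> alpha0)"
  "perm5 2 4 1 5 3 = alpha0 \<circ> delta0"
  "perm5 3 5 4 2 1 = alpha0 \<circ> (beta0 \<circ> (delta0 \<circ> beta0))"
  "perm5 3 1 5 2 4 = delta0 \<circ> alpha0"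
  "perm5 4 3 5 2 1 = alpha0 \<circ> (epsilon0 \<circ> beta0 \<circ> alpha0)"
  "perm5 4 3 1 5 2 = epsilon0 \<circ> beta0"
  "perm5 2 5 4 1 3 = beta0 \<circ> (gamma0 \<circ> beta0 \<circ> alpha0)"
  "perm5 5 1 2 3 4 = alpha0 \<circ> (beta0 \<circ> (gamma0 \<circ> beta0))"
  by (simp_all add: word0_defs)

lemma phi_words:
  "gamma0 \<circ> gamma0 = beta0 \<circ> (gamma0 \<circ> beta0)"
  "gamma0 \<circ> (gamma0 \<circ> gamma0) = id"
  "gamma0 \<circ> (alpha0 \<circ> (gamma0 \<circ> gamma0)) = delta0"
  "gamma0 \<circ> (beta0 \<circ> (gamma0 \<circ> gamma0)) = beta0 \<circ> gamma0"
  "gamma0 \<circ> (beta0 \<circ> (alpha0 \<circ> (gamma0 \<circ> gamma0))) = epsilon0"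
  "gamma0 \<circ> alpha0 \<circ> gamma0 \<circ> (gamma0 \<circ> gamma0) = gamma0 \<circ> alpha0"
  "gamma0 \<circ> alpha0 \<circ> gamma0 \<circ> (beta0 \<circ> (gamma0 \<circ> gamma0)) = delta0 \<circ> beta0"
  "gamma0 \<circ> alpha0 \<circ> gamma0 \<circ> (beta0 \<circ> (alpha0 \<circ> (gamma0 \<circ> gamma0)))
     = alpha0 \<circ> (beta0 \<circ> (epsilon0 \<circ> beta0 \<circ> alpha0))"
  by (simp_all add: word0_defs id_eq_perm5)

text \<open>What remains of the rotation module: unique divisibility by 2, and the fact that \<open>\<beta>\<close>
  inverts the fixed points of \<open>\<alpha>\<close>, which form the axis of \<open>\<alpha>\<close>.\<close>

locale standard_icosahedral_action = additive_gmodule Alt5 act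
  for act :: "(nat \<Rightarrow> nat) \<Rightarrow> 'v::ab_group_add \<Rightarrow> 'v" +
  assumes double_inj: "\<And>v w :: 'v. v + v = w + w \<Longrightarrow> v = w"
    and double_surj: "\<And>v :: 'v. \<exists>w. v = w + w"
    and beta0_inverts: "\<And>l. act alpha0 l = l \<Longrightarrow> act beta0 l = - l"
begin

lemma act_comp: "g \<in> A5 \<Longrightarrow> h \<in> A5 \<Longrightarrow> act (g \<circ> h) v = act g (act h v)"
  using act_mult[of g h v] by simp

lemma act_id: "act id v = v"
  using act_one by simp

text \<open>Up to the factor 2, this is the component of \<open>p l\<close> along the axis of \<open>\<alpha>\<close>. It is used
  for \<open>l\<close> on that axis, where it plays the role of a matrix coefficient.\<close>

definition T :: "(nat \<Rightarrow> nat) \<Rightarrow> 'v \<Rightarrow> 'v" where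
  "T p l = act p l + act alpha0 (act p l)"

lemma alpha0_twice: "act alpha0 (act alpha0 v) = v"
  using act_comp[OF alpha0_in alpha0_in, of v] by (simp add: gen0_defs id_eq_perm5[symmetric, simplified] act_id)

lemma alpha0_beta0: "act alpha0 (act beta0 v) = act beta0 (act alpha0 v)"
  using act_comp[OF alpha0_in beta0_in, of v] act_comp[OF beta0_in alpha0_in, of v]
  by (simp add: gen0_defs)

lemma T_fixed: "act alpha0 (T p l) = T p l"
  by (simp add: T_def act_add alpha0_in alpha0_twice add.commute)

lemma T_add: "p \<in> A5 \<Longrightarrow> T p (v + w) = T p v + T p w"
  by (simp add: T_def act_add alpha0_in algebra_simps)

lemma T_diff: "p \<in> A5 \<Longrightarrow> T p (v - w) = T p v - T p w"
  by (simp add: T_def act_diff alpha0_in algebra_simps)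

lemma T_alpha_left: "p \<in> A5 \<Longrightarrow> T (alpha0 \<circ> p) l = T p l"
  by (simp add: T_def act_comp alpha0_in alpha0_twice add.commute)

lemma T_beta_left: "p \<in> A5 \<Longrightarrow> T (beta0 \<circ> p) l = - T p l"
  using beta0_inverts[OF T_fixed, of p l]
  by (simp add: T_def act_comp alpha0_in beta0_in alpha0_beta0 act_add)

lemma T_alpha_right: "p \<in> A5 \<Longrightarrow> act alpha0 l = l \<Longrightarrow> T (p \<circ> alpha0) l = T p l"
  by (simp add: T_def act_comp alpha0_in)

lemma T_beta_right: "p \<in> A5 \<Longrightarrow> act alpha0 l = l \<Longrightarrow> T (p \<circ> beta0) l = - T p l"
  by (simp add: T_def act_comp beta0_in beta0_inverts act_minus alpha0_in)

lemma T_beta_alpha_right: "p \<in> A5 \<Longrightarrow> act alpha0 l = l \<Longrightarrow> T (p \<circ> beta0 \<circ> alpha0) l = - T p l"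
  by (simp add: T_alpha_right T_beta_right alt5_comp beta0_in)

lemmas T_simps = T_alpha_left T_beta_left T_alpha_right T_beta_right T_beta_alpha_right
  alpha0_in beta0_in gamma0_in delta0_in epsilon0_in alt5_comp

lemma klein_four_norm: "v + act alpha0 v + act beta0 v + act beta0 (act alpha0 v) = 0"
proof -
  have "act beta0 (v + act alpha0 v) = - (v + act alpha0 v)"
    by (rule beta0_inverts) (simp add: act_add alpha0_in alpha0_twice add.commute)
  then show ?thesis
    by (simp add: act_add beta0_in add.assoc)
qed

text \<open>The norm of the Klein four-group kills \<open>V\<close>; multiplying by \<open>h\<close> and \<open>g\<close> and projecting to
  the axis gives a linear relation among the coefficients.\<close>

lemma T_norm_relation:
  assumes "g \<in> A5" "h \<in> A5"
  shows "T (h \<circ> g) l + T (h \<circ> (alpha0 \<circ> g)) l + T (h \<circ> (beta0 \<circ> g)) l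
    + T (h \<circ> (beta0 \<circ> (alpha0 \<circ> g))) l = 0"
proof -
  let ?v = "act g l"
  have "act h (?v + act alpha0 ?v + act beta0 ?v + act beta0 (act alpha0 ?v)) = 0"
    by (simp add: klein_four_norm act_zero assms)
  then have "act h ?v + act h (act alpha0 ?v) + act h (act beta0 ?v) + act h (act beta0 (act alpha0 ?v)) = 0"
    (is "?s = 0") by (simp only: act_add assms)
  moreover have "T (h \<circ> g) l + T (h \<circ> (alpha0 \<circ> g)) l + T (h \<circ> (beta0 \<circ> g)) l
    + T (h \<circ> (beta0 \<circ> (alpha0 \<circ> g))) l = ?s + act alpha0 ?s"
    using assms by (simp add: T_def act_comp alt5_comp alpha0_in beta0_in act_add algebra_simps)
  ultimately show ?thesis by (simp add: act_zero alpha0_in)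
qed

context
  fixes l :: 'v assumes l: "act alpha0 l = l"
begin

lemma T_id: "T id l = l + l"
  by (simp add: T_def act_id l)

text \<open>This element of order three normalizes the Klein four-group and carries the axis of \<open>\<alpha>\<close>
  to that of another of its involutions, which \<open>\<alpha>\<close> inverts.\<close>

lemma T_order3: "T (gamma0 \<circ> alpha0 \<circ> gamma0 \<circ> (alpha0 \<circ> (gamma0 \<circ> gamma0))) l = 0" (is "T ?z l = 0")
proof -
  have eq: "alpha0 \<circ> ?z = ?z \<circ> alpha0 \<circ> beta0" and z: "?z \<in> A5"
    by (simp add: gen0_defs) (intro alt5_comp alpha0_in gamma0_in)
  have "act alpha0 (act ?z l) = act (?z \<circ> alpha0 \<circ> beta0) l"
    using act_comp[OF alpha0_in z] eq by simp
  also have "\<dots> = - act ?z l"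
    by (simp only: act_comp alt5_comp z alpha0_in beta0_in beta0_inverts[OF l] act_minus l)
  finally show ?thesis by (simp add: T_def)
qed

text \<open>Write \<open>F\<close>, \<open>D\<close>, \<open>E\<close> for the coefficients of \<open>\<gamma>\<close>, \<open>\<delta>\<close>, \<open>\<epsilon>\<close>. Conjugating the norm by
  \<open>\<gamma>\<close> gives \<open>2 + D - F + E = 0\<close>, and the norm between \<open>\<gamma>\<alpha>\<gamma>\<close> and \<open>\<gamma>\<^sup>2\<close> gives
  \<open>F - D + E = 0\<close>. The sum of both says \<open>2 E = - 2\<close>.\<close>

lemma T_delta0: "T delta0 l = T gamma0 l - l" and T_epsilon0: "T epsilon0 l = - l"
proof -
  note gg = alt5_comp[OF gamma0_in gamma0_in] and gag = alt5_comp[OF alt5_comp[OF gamma0_in alpha0_in] gamma0_in]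
  have 1: "l + l + T delta0 l - T gamma0 l + T epsilon0 l = 0"
    using T_norm_relation[OF gg gamma0_in, of l]
    unfolding phi_words(2-) by (simp add: T_id T_simps l)
  have 2: "T gamma0 l - T delta0 l + T epsilon0 l = 0"
    using T_norm_relation[OF gg gag, of l]
    unfolding T_order3 phi_words(2-) by (simp add: T_simps l)
  have "(T epsilon0 l + T epsilon0 l) - (- l + - l)
      = (l + l + T delta0 l - T gamma0 l + T epsilon0 l) + (T gamma0 l - T delta0 l + T epsilon0 l)"
    by (simp add: algebra_simps)
  then have "T epsilon0 l + T epsilon0 l = - l + - l"
    unfolding 1 2 by (simp only: add_0 right_minus_eq)
  then show e: "T epsilon0 l = - l" by (rule double_inj)
  show "T delta0 l = T gamma0 l - l"
    using 2 e by (simp add: algebra_simps)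
qed

lemma T_gamma0_square: "T (gamma0 \<circ> gamma0) l = T gamma0 l"
  unfolding phi_words(1) by (simp add: T_simps l)

text \<open>The double coset of each of \<open>\<gamma>\<close>, \<open>\<delta>\<close>, \<open>\<epsilon>\<close> contains four vertices, with sign \<open>-\<close> only
  for \<open>\<epsilon>\<close>: the sum is \<open>4 F + 4 (F - 1) + 4 = 8 F\<close>.\<close>

lemma T_vertices: "(\<Sum>p\<in>vertices0. T p l) = 
   (T gamma0 l + T gamma0 l + T gamma0 l + T gamma0 l) + (T gamma0 l + T gamma0 l + T gamma0 l + T gamma0 l)"
proof -
  have "(\<Sum>p\<in>vertices0. T p l) = 
   T gamma0 l + T gamma0 l + T gamma0 l + T gamma0 l + T delta0 l + T delta0 l + T delta0 l + T delta0 l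
    - T epsilon0 l - T epsilon0 l - T epsilon0 l - T epsilon0 l"
    unfolding vertices0_def apply (simp del: One_nat_def)
    unfolding vertices0_words by (simp add: T_simps l)
  then show ?thesis by (simp add: T_delta0 T_epsilon0 algebra_simps)
qed

text \<open>The class sum commutes with \<open>\<alpha>\<close> and so maps the axis to itself, where projecting only
  doubles it.\<close>

lemma class_sum_eq_T:
  "(\<Sum>p\<in>vertices0. act p l) = T gamma0 l + T gamma0 l + T gamma0 l + T gamma0 l" (is "?S = _")
proof (rule double_inj)
  have v: "p \<in> A5" if "p \<in> vertices0" for p
    using that vertices0_subset by blast
  have inv: "conj_by alpha0 (conj_by alpha0 p) = p" for p
    by (metis alpha0_in alt5_bij conj_by_inverse inv_gen0(1))
  have "act alpha0 ?S = (\<Sum>p\<in>vertices0. act (alpha0 \<circ> p \<circ> alpha0) l)"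
    by (auto simp: act_sum alpha0_in act_comp alt5_comp v l intro!: sum.cong)
  also have "\<dots> = (\<Sum>p\<in>vertices0. act (conj_by alpha0 p) l)"
    by (simp add: conj_by_def inv_gen0)
  also have "\<dots> = ?S"
    by (rule sum.reindex_bij_witness[of _ "conj_by alpha0" "conj_by alpha0"])
      (simp_all add: inv conj_gen0_vertices0)
  finally have "?S + ?S = (\<Sum>p\<in>vertices0. T p l)"
    by (simp add: T_def sum.distrib act_sum alpha0_in)
  then show "?S + ?S = (T gamma0 l + T gamma0 l + T gamma0 l + T gamma0 l)
      + (T gamma0 l + T gamma0 l + T gamma0 l + T gamma0 l)"
    by (simp only: T_vertices)
qed

text \<open>Because \<open>\<gamma>\<close> and \<open>\<gamma>\<^sup>2\<close> have the same coefficient, \<open>F\<^sup>2\<close> is the projection of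
  \<open>\<gamma> (1 + \<alpha>) \<gamma>\<^sup>2 = 1 + \<delta>\<close>, which is \<open>2 + (F - 1)\<close>.\<close>

lemma T_T_gamma0: "T gamma0 (T gamma0 l) = T gamma0 l + l"
proof -
  note gg = alt5_comp[OF gamma0_in gamma0_in]
  have "T gamma0 (T gamma0 l) = T gamma0 (T (gamma0 \<circ> gamma0) l)"
    by (simp only: T_gamma0_square)
  also have "\<dots> = T (gamma0 \<circ> (gamma0 \<circ> gamma0)) l + T (gamma0 \<circ> (alpha0 \<circ> (gamma0 \<circ> gamma0))) l"
    using gg by (simp add: T_def act_comp alt5_comp gamma0_in alpha0_in act_add algebra_simps)
  also have "\<dots> = T gamma0 l + l"
    unfolding phi_words(2,3) by (simp add: T_id T_delta0)
  finally show ?thesis .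
qed

end

end

section \<open>Decomposition into three axes\<close>

text \<open>The 3-cycle \<open>(1 2 4)\<close> normalizes the Klein four-group and permutes its involutions
  cyclically.\<close>

definition "sigma0 = perm5 2 4 3 1 5"

lemma sigma0_word: "sigma0 = gamma0 \<circ> alpha0 \<circ> gamma0 \<circ> alpha0 \<circ> gamma0 \<circ> gamma0"
  by (simp add: sigma0_def gen0_defs)

lemma sigma0_in: "sigma0 \<in> A5"
  unfolding sigma0_word by (intro alt5_comp alpha0_in gamma0_in)

lemma sigma0_words:
  "sigma0 \<circ> (sigma0 \<circ> sigma0) = id"
  "sigma0 \<circ> (alpha0 \<circ> (sigma0 \<circ> sigma0)) = beta0"
  "sigma0 \<circ> sigma0 \<circ> (alpha0 \<circ> sigma0) = beta0 \<circ> alpha0"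
  by (simp_all add: sigma0_def gen0_defs id_eq_perm5)

context standard_icosahedral_action
begin

abbreviation axis0 :: "'v set" where "axis0 \<equiv> {l. act alpha0 l = l}"

lemma axis0_add: "l \<in> axis0 \<Longrightarrow> m \<in> axis0 \<Longrightarrow> l + m \<in> axis0"
  and axis0_minus: "l \<in> axis0 \<Longrightarrow> - l \<in> axis0"
  by (simp_all add: act_add act_minus alpha0_in)

lemma axis0_half:
  assumes "l \<in> axis0" obtains m where "m \<in> axis0" "l = m + m"
proof -
  obtain m where m: "l = m + m" using double_surj by blast
  have "act alpha0 m + act alpha0 m = m + m"
    using assms by (simp add: m act_add alpha0_in)
  then have "act alpha0 m = m" by (rule double_inj)
  then show ?thesis using that m by simp
qed

lemma trace_in_axis0: "v + act alpha0 v \<in> axis0"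
  by (simp add: act_add alpha0_in alpha0_twice add.commute)

text \<open>The three summands are the axes of \<open>\<alpha>\<close> and of its conjugates by \<open>\<gamma>\<^sup>2\<close> and \<open>\<gamma>\<close>. The
  order of the arguments is that of the lattice basis \<open>e1, e2, e3\<close>, where \<open>e3\<close> is fixed by
  \<open>\<alpha>\<close>.\<close>

definition from_axes :: "'v \<Rightarrow> 'v \<Rightarrow> 'v \<Rightarrow> 'v" where
  "from_axes l1 l2 l3 = act (gamma0 \<circ> gamma0) l1 + act gamma0 l2 + l3"

lemma gamma0_thrice: "act gamma0 (act gamma0 (act gamma0 v)) = v"
  using phi_words(2) act_comp[OF gamma0_in alt5_comp[OF gamma0_in gamma0_in], of v]
  by (simp add: act_comp gamma0_in act_id)

lemma from_axes_gamma0: "act gamma0 (from_axes l1 l2 l3) = from_axes l2 l3 l1"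
  by (simp add: from_axes_def act_add act_comp gamma0_in gamma0_thrice algebra_simps)

lemma alpha0_eq_T: "p \<in> A5 \<Longrightarrow> act alpha0 (act p l) = T p l - act p l"
  by (simp add: T_def)

lemma from_axes_alpha0:
  assumes "l1 \<in> axis0" "l2 \<in> axis0" "l3 \<in> axis0"
  shows "act alpha0 (from_axes l1 l2 l3) = from_axes (- l1) (- l2) (l3 + T gamma0 l1 + T gamma0 l2)"
  using assms alt5_comp[OF gamma0_in gamma0_in]
  by (simp add: from_axes_def act_add alpha0_in alpha0_eq_T gamma0_in T_gamma0_square act_minus algebra_simps)

lemma from_axes_add:
  "from_axes (l1 + m1) (l2 + m2) (l3 + m3) = from_axes l1 l2 l3 + from_axes m1 m2 m3"
  using alt5_comp[OF gamma0_in gamma0_in] by (simp add: from_axes_def act_add gamma0_in algebra_simps)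

text \<open>Projecting a relation to each of the three axes yields a linear system whose matrix has \<open>2\<close>
  on the diagonal and \<open>F\<close> elsewhere. Its eigenvalues are \<open>2 - F\<close> on differences and \<open>2 + 2 F\<close> on
  constant vectors, and both are injective because \<open>F\<^sup>2 = F + 1\<close>.\<close>

lemma from_axes_eq_0:
  assumes l: "l1 \<in> axis0" "l2 \<in> axis0" "l3 \<in> axis0" and zero: "from_axes l1 l2 l3 = 0"
  shows "l1 = 0 \<and> l2 = 0 \<and> l3 = 0"
proof -
  let ?F = "T gamma0"
  have row: "?F a + ?F b + (c + c) = 0"
    if "a \<in> axis0" "b \<in> axis0" "c \<in> axis0" "from_axes a b c = 0" for a b c
  proof -
    have "from_axes a b c + act alpha0 (from_axes a b c) = 0"
      using that(4) by (simp add: act_zero alpha0_in)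
    then show ?thesis
      using that(1-3) alt5_comp[OF gamma0_in gamma0_in]
      by (simp add: from_axes_alpha0) (simp add: from_axes_def act_minus gamma0_in algebra_simps)
  qed
  have z2: "from_axes l2 l3 l1 = 0" "from_axes l3 l1 l2 = 0"
    using zero from_axes_gamma0 act_zero[OF gamma0_in] by metis+
  note r = row[OF l zero] row[OF l(2,3,1) z2(1)] row[OF l(3,1,2) z2(2)]
  \<comment> \<open>On the kernel of \<open>F - 2\<close> the equation \<open>F\<^sup>2 = F + 1\<close> reads \<open>4 = 3\<close>.\<close>
  have eq: "d = 0" if d: "d \<in> axis0" "?F d = d + d" for d
  proof -
    have "?F (?F d) = (d + d) + (d + d)"
      using d by (simp add: T_add gamma0_in)
    moreover have "?F (?F d) = d + d + d"
      using T_T_gamma0[of d] d by simp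
    ultimately show "d = 0" by (simp add: add.assoc)
  qed
  have diff: "a = b" if "a \<in> axis0" "b \<in> axis0" "c \<in> axis0"
      "?F b + ?F c + (a + a) = 0" "?F c + ?F a + (b + b) = 0" for a b c
  proof -
    have "(?F b + ?F c + (a + a)) - (?F c + ?F a + (b + b)) = (a - b) + (a - b) - ?F (a - b)"
      by (simp add: T_diff gamma0_in algebra_simps)
    then have "?F (a - b) = (a - b) + (a - b)"
      using that(4,5) by simp
    then have "a - b = 0"
      using that(1,2) by (intro eq) (simp_all add: act_diff alpha0_in)
    then show "a = b" by simp
  qed
  have "l1 = l2"
    by (rule diff[of l1 l2 l3]) (use l r in \<open>simp_all add: algebra_simps\<close>)
  moreover have "l2 = l3"
    by (rule diff[of l2 l3 l1]) (use l r in \<open>simp_all add: algebra_simps\<close>)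
  ultimately have e: "l2 = l1" "l3 = l1" by simp_all
  \<comment> \<open>The common value satisfies \<open>F l = - l\<close>, and then \<open>F\<^sup>2 = F + 1\<close> reads \<open>1 = 0\<close>.\<close>
  have "(?F l1 + l1) + (?F l1 + l1) = 0 + 0"
    using r(1) by (simp add: e algebra_simps)
  then have F: "?F l1 + l1 = 0" by (rule double_inj)
  then have "?F (?F l1 + l1) = 0"
    using T_add[OF gamma0_in, of 0 0] by simp
  then have "?F l1 + l1 + ?F l1 = 0"
    using l(1) by (simp add: T_add gamma0_in T_T_gamma0)
  then have "?F l1 = 0" using F by simp
  then show ?thesis using F e by simp
qed

text \<open>The image is a submodule containing the axis of \<open>\<alpha>\<close>, hence also the axes of \<open>\<beta>\<close> and
  \<open>\<beta>\<alpha>\<close>. Since the norm vanishes, \<open>2 v\<close> is the sum of its projections to these three axes, and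
  the image is closed under halving.\<close>

lemma from_axes_surj:
  obtains l1 l2 l3 where "l1 \<in> axis0" "l2 \<in> axis0" "l3 \<in> axis0" "v = from_axes l1 l2 l3"
proof -
  let ?W = "{from_axes l1 l2 l3 | l1 l2 l3. l1 \<in> axis0 \<and> l2 \<in> axis0 \<and> l3 \<in> axis0}"
  have 0: "0 \<in> axis0" by (simp add: act_zero alpha0_in)
  have add: "u + w \<in> ?W" if u: "u \<in> ?W" and w: "w \<in> ?W" for u w
  proof -
    obtain l1 l2 l3 where l: "l1 \<in> axis0" "l2 \<in> axis0" "l3 \<in> axis0" "u = from_axes l1 l2 l3"
      using u by blast
    obtain m1 m2 m3 where m: "m1 \<in> axis0" "m2 \<in> axis0" "m3 \<in> axis0" "w = from_axes m1 m2 m3"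
      using w by blast
    have "u + w = from_axes (l1 + m1) (l2 + m2) (l3 + m3)"
      by (simp only: l m from_axes_add)
    then show ?thesis using axis0_add l m by blast
  qed
  have stable: "\<forall>w \<in> ?W. act h w \<in> ?W" if "h \<in> A5" for h
    using alpha0_gamma0_generators that
  proof (induction rule: icosa_generators_induct)
    case id
    then show ?case by (simp only: act_id) blast
  next
    case (alpha h)
    have "act alpha0 w \<in> ?W" if w: "w \<in> ?W" for w
    proof -
      obtain l1 l2 l3 where l: "l1 \<in> axis0" "l2 \<in> axis0" "l3 \<in> axis0" "w = from_axes l1 l2 l3"
        using w by blast
      have "l3 + T gamma0 l1 + T gamma0 l2 \<in> axis0"
        by (intro axis0_add l(3)) (simp_all add: T_fixed)
      then show ?thesis
        using l from_axes_alpha0[OF l(1-3)] axis0_minus by blast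
    qed
    then show ?case using alpha by (simp only: act_comp alpha0_in) blast
  next
    case (gamma h)
    have "act gamma0 w \<in> ?W" if "w \<in> ?W" for w
      using that from_axes_gamma0 by blast
    then show ?case using gamma by (simp only: act_comp gamma0_in) blast
  qed
  have axis: "l \<in> ?W" if "l \<in> axis0" for l
  proof -
    have "l = from_axes 0 0 l"
      using alt5_comp[OF gamma0_in gamma0_in] by (simp add: from_axes_def act_zero gamma0_in)
    then show ?thesis using that 0 by blast
  qed
  note ss = alt5_comp[OF sigma0_in sigma0_in]
  \<comment> \<open>The projections to the other two axes are conjugated to that of \<open>\<alpha>\<close> by powers of \<open>\<sigma>\<close>.\<close>
  have 2: "v + act beta0 v = act sigma0 (act (sigma0 \<circ> sigma0) v + act alpha0 (act (sigma0 \<circ> sigma0) v))"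
    by (simp only: act_add act_comp[symmetric] sigma0_in alpha0_in ss alt5_comp sigma0_words act_id)
  have 3: "v + act beta0 (act alpha0 v)
      = act (sigma0 \<circ> sigma0) (act sigma0 v + act alpha0 (act sigma0 v))"
    by (simp only: act_add act_comp[symmetric] sigma0_in beta0_in alpha0_in ss alt5_comp sigma0_words(3)
      sigma0_words(1)[folded comp_assoc] act_id)
  have "v + v = (v + act alpha0 v) + (v + act beta0 v) + (v + act beta0 (act alpha0 v))
      - (v + act alpha0 v + act beta0 v + act beta0 (act alpha0 v))"
    by (simp add: algebra_simps)
  also have "\<dots> = (v + act alpha0 v) + (v + act beta0 v) + (v + act beta0 (act alpha0 v))"
    by (simp only: klein_four_norm diff_0_right)
  also have "\<dots> \<in> ?W"
    unfolding 2 3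
    by (rule add[OF add[OF axis[OF trace_in_axis0] bspec[OF stable[OF sigma0_in] axis[OF trace_in_axis0]]]
          bspec[OF stable[OF ss] axis[OF trace_in_axis0]]])
  finally obtain l1 l2 l3 where l: "l1 \<in> axis0" "l2 \<in> axis0" "l3 \<in> axis0" "v + v = from_axes l1 l2 l3"
    by blast
  obtain m1 m2 m3 where m: "m1 \<in> axis0" "m2 \<in> axis0" "m3 \<in> axis0"
      "l1 = m1 + m1" "l2 = m2 + m2" "l3 = m3 + m3"
    by (rule axis0_half[OF l(1)], rule axis0_half[OF l(2)], rule axis0_half[OF l(3)])
  have "v + v = from_axes m1 m2 m3 + from_axes m1 m2 m3"
    by (simp only: l(4) m(4-6) from_axes_add)
  then have "v = from_axes m1 m2 m3" by (rule double_inj)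
  then show ?thesis using that m by blast
qed

end

section \<open>The golden module structure\<close>

lemma nmult_simps [simp]: "nmult 0 v = 0" "nmult (Suc n) v = nmult n v + v"
  by (simp_all add: nmult_def lessThan_Suc add.commute)

text \<open>Integer multiples are the powers of the additive group, so the laws of scalar multiplication
  come from those of powers.\<close>

lemma nmult_eq_pow: "nmult n v = v [^]\<^bsub>add_group\<^esub> n"
  by (induction n) (simp_all add: nat_pow_def)

lemma zmult_eq_pow: "zmult k v = v [^]\<^bsub>add_group\<^esub> k"
  by (simp add: zmult_def int_pow_def2 nmult_eq_pow[symmetric])

lemma zmult_simps:
  "zmult 0 v = 0" "zmult 1 v = v" "zmult (i + j) v = zmult i v + zmult j v"
  "zmult i (v + w) = zmult i v + zmult i w" "zmult i (zmult j v) = zmult (i * j) v"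
  "zmult (- i) v = - zmult i v"
proof -
  interpret comm_group "add_group :: 'a monoid" by (rule comm_group_add_group)
  show "zmult (i + j) v = zmult i v + zmult j v" "zmult i (v + w) = zmult i v + zmult i w"
    "zmult i (zmult j v) = zmult (i * j) v" "zmult (- i) v = - zmult i v"
    using int_pow_mult[of v i j] int_pow_distrib[of v w i] int_pow_pow[of v j i] int_pow_neg[of v i]
    by (simp_all add: zmult_eq_pow mult.commute)
qed (simp_all add: zmult_def)

lemma additive_zmult:
  fixes f :: "'a::ab_group_add \<Rightarrow> 'a"
  assumes "\<And>v w. f (v + w) = f v + f w"
  shows "f (zmult k v) = zmult k (f v)"
proof -
  interpret comm_group "add_group :: 'a monoid" by (rule comm_group_add_group)
  have "f \<in> hom (add_group :: 'a monoid) add_group"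
    using assms by (auto simp: hom_def)
  from hom_int_pow[OF this] show ?thesis
    by (simp add: zmult_eq_pow)
qed

lemma subgroup_zmult:
  assumes "subgroup L (add_group :: 'a::ab_group_add monoid)" "v \<in> L" shows "zmult k v \<in> L"
proof -
  interpret comm_group "add_group :: 'a monoid" by (rule comm_group_add_group)
  show ?thesis using subgroup_int_pow_closed[OF assms] by (simp add: zmult_eq_pow)
qed

lemma quarter_eq:
  fixes v :: "'a::ab_group_add"
  assumes "\<And>v w :: 'a. v + v = w + w \<Longrightarrow> v = w"
  shows "quarter (v + v + v + v) = v"
proof -
  have 4: "nmult 4 w = (w + w) + (w + w)" for w :: 'a
    by (simp add: eval_nat_numeral add.assoc)
  show ?thesis
    unfolding quarter_def 4
  proof (rule the_equality)
    fix w assume "v + v + v + v = (w + w) + (w + w)"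
    then have "(v + v) + (v + v) = (w + w) + (w + w)" by (simp only: add.assoc)
    then show "w = v" using assms by metis
  qed (simp only: add.assoc)
qed

text \<open>An additive endomorphism that satisfies the golden equation on a subgroup turns this subgroup
  into a module over the golden integers.\<close>

lemma module_golden_axis:
  fixes act :: "(nat \<Rightarrow> nat) \<Rightarrow> 'v::ab_group_add \<Rightarrow> 'v"
    and \<alpha> :: "nat \<Rightarrow> nat" and C :: "(nat \<Rightarrow> nat) set"
  defines "L \<equiv> range (trace_map Alt5 act \<alpha>)" and "f \<equiv> phi_endo act C"
  assumes L: "subgroup L (add_group :: 'v monoid)"
    and add: "\<And>v w. f (v + w) = f v + f w"
    and closed: "\<And>l. l \<in> L \<Longrightarrow> f l \<in> L"
    and golden: "\<And>l. l \<in> L \<Longrightarrow> f (f l) = f l + l"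
  shows "module golden_ring (axis_module act \<alpha> C)"
proof -
  have Ladd: "l + m \<in> L" "zmult k l \<in> L" "0 \<in> L" "- l \<in> L" if "l \<in> L" "m \<in> L" for l m k
    using subgroup.m_closed[OF L that] subgroup_zmult[OF L that(1)] subgroup.one_closed[OF L]
      subgroup.m_inv_closed[OF L that(1)] by simp_all
  have M: "axis_module act \<alpha> C = \<lparr>carrier = L, monoid.mult = undefined, one = undefined, ring.zero = 0,
     add = (+), smult = \<lambda>(a, b) l. zmult a l + zmult b (f l)\<rparr>"
    by (simp add: axis_module_def L_def f_def)
  note fz = additive_zmult[of f, OF add]
  show ?thesis
    unfolding M
  proof (rule moduleI)
    show "cring golden_ring" by (rule cring_golden_ring)
    show "abelian_group \<lparr>carrier = L, monoid.mult = undefined, one = undefined, ring.zero = 0,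
       add = (+), smult = \<lambda>(a, b) l. zmult a l + zmult b (f l)\<rparr>" (is "abelian_group ?M")
    proof (rule abelian_groupI)
      fix x assume "x \<in> carrier ?M"
      then show "\<exists>y\<in>carrier ?M. y \<oplus>\<^bsub>?M\<^esub> x = \<zero>\<^bsub>?M\<^esub>"
        using Ladd by (intro bexI[of _ "- x"]) simp_all
    qed (use Ladd subgroup.one_closed[OF L] in \<open>auto simp: algebra_simps\<close>)
  qed (use Ladd closed in \<open>auto simp: golden_ring_def zmult_simps fz add golden algebra_simps\<close>)
qed

section \<open>The action on the icosahedral lattice\<close>

text \<open>The coordinate along the axis of \<open>\<alpha>\<close> of the vertices of a suitably scaled icosahedron: it
  takes the values \<open>\<plusminus>\<phi>\<close>, \<open>\<plusminus>1\<close> at two vertices each and vanishes at the four 5-cycles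
  inverted by \<open>\<alpha>\<close>.\<close>

definition height0 :: "(nat \<Rightarrow> nat) \<Rightarrow> golden" where
  "height0 p =
    (if p = perm5 4 1 5 3 2 \<or> p = perm5 2 3 4 5 1 then (0, 1)
     else if p = perm5 3 5 2 1 4 \<or> p = perm5 5 4 2 1 3 then (1, 0)
     else if p = perm5 4 3 5 2 1 \<or> p = perm5 4 3 1 5 2 then (- 1, 0)
     else if p = perm5 2 5 4 1 3 \<or> p = perm5 5 1 2 3 4 then (0, - 1)
     else (0, 0))"

text \<open>The heights of the vertices in direction \<open>x e1 + y e2 + z e3\<close>. The direction \<open>e2\<close> is the
  image of \<open>e3\<close> under \<open>\<gamma>\<close> and \<open>e1\<close> that of \<open>e2\<close>, so their heights are those of \<open>e3\<close> at
  conjugated vertices. This embeds the lattice into the functions on the vertices, on which the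
  group acts by conjugating the argument.\<close>

fun heights :: "golden \<times> golden \<times> golden \<Rightarrow> (nat \<Rightarrow> nat) \<Rightarrow> golden" where
  "heights (x, y, z) p =
     x \<otimes>\<^bsub>golden_ring\<^esub> height0 (gamma0 \<circ> p \<circ> (gamma0 \<circ> gamma0)) \<oplus>\<^bsub>golden_ring\<^esub>
     y \<otimes>\<^bsub>golden_ring\<^esub> height0 (gamma0 \<circ> gamma0 \<circ> p \<circ> gamma0) \<oplus>\<^bsub>golden_ring\<^esub>
     z \<otimes>\<^bsub>golden_ring\<^esub> height0 p"

text \<open>The matrices of the two generators, with \<open>\<phi> (a + b \<phi>) = b + (a + b) \<phi>\<close>.\<close>

fun icosa_alpha :: "golden \<times> golden \<times> golden \<Rightarrow> golden \<times> golden \<times> golden" where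
  "icosa_alpha ((a, b), (c, d), (e, f)) = ((- a, - b), (- c, - d), (e + b + d, f + a + b + c + d))"

fun icosa_gamma :: "golden \<times> golden \<times> golden \<Rightarrow> golden \<times> golden \<times> golden" where
  "icosa_gamma (x, y, z) = (y, z, x)"

lemma heights_alpha:
  assumes "p \<in> vertices0"
  shows "heights (icosa_alpha v) p = heights v (alpha0 \<circ> p \<circ> alpha0)"
proof -
  obtain a b c d e f where v: "v = ((a, b), (c, d), (e, f))" by (metis surj_pair)
  show ?thesis
    using assms unfolding vertices0_def v
    by (elim insertE emptyE; simp add: gen0_defs height0_def golden_ring_def)
qed

lemma heights_gamma:
  "heights (icosa_gamma v) p = heights v (gamma0 \<circ> gamma0 \<circ> p \<circ> gamma0)"
proof -
  obtain x y z where v: "v = (x, y, z)" by (metis surj_pair)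
  have g: "gamma0 \<circ> (gamma0 \<circ> (gamma0 \<circ> p)) = p" "p \<circ> (gamma0 \<circ> (gamma0 \<circ> gamma0)) = p"
    "gamma0 \<circ> (gamma0 \<circ> (gamma0 \<circ> (gamma0 \<circ> p))) = gamma0 \<circ> p" for p
    using phi_words(2) by (simp_all add: comp_assoc[symmetric] flip: id_def)
  show ?thesis
    unfolding v by (simp add: comp_assoc g golden_ring_def split: prod.splits)
qed

text \<open>At these three vertices the heights are the three coordinates themselves.\<close>

lemma heights_eqD:
  assumes "\<And>p. p \<in> vertices0 \<Longrightarrow> heights v p = heights w p"
  shows "v = w"
proof -
  obtain a b c d e f where v: "v = ((a, b), (c, d), (e, f))" by (metis surj_pair)
  obtain a' b' c' d' e' f' where w: "w = ((a', b'), (c', d'), (e', f'))" by (metis surj_pair)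
  note * = assms[of "perm5 5 4 2 1 3"] assms[of "perm5 5 4 1 3 2"] assms[of "perm5 2 4 1 5 3"]
  show ?thesis
    using * unfolding v w
    by (simp add: gen0_defs height0_def golden_ring_def vertices0_def)
qed

lemma heights_add:
  "heights (v \<oplus>\<^bsub>icosa_lattice\<^esub> w) p = heights v p \<oplus>\<^bsub>golden_ring\<^esub> heights w p"
  by (cases v; cases w) (auto simp: icosa_lattice_def golden_ring_def algebra_simps split: prod.splits)

lemma heights_smult:
  "heights (r \<odot>\<^bsub>icosa_lattice\<^esub> v) p = r \<otimes>\<^bsub>golden_ring\<^esub> heights v p"
  by (cases v) (auto simp: icosa_lattice_def golden_ring_def algebra_simps split: prod.splits)

lemma icosa_lattice_carrier [simp]:
  "carrier icosa_lattice = UNIV" "carrier (add_monoid icosa_lattice) = UNIV"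
  by (simp_all add: icosa_lattice_def)

lemma lattice_action_generators:
  assumes "icosa_lattice_action \<alpha> \<gamma> \<rho>" "\<alpha> \<in> A5" "\<gamma> \<in> A5"
  shows "\<rho> \<alpha> v = icosa_alpha v" and "\<rho> \<gamma> v = icosa_gamma v"
proof -
  interpret M: module golden_ring icosa_lattice by (rule module_icosa_lattice)
  obtain x y z where v: "v = (x, y, z)" by (metis surj_pair)
  note D = assms(1)[unfolded icosa_lattice_action_def]
  have gm: "gmodule Alt5 (add_monoid icosa_lattice) \<rho>" using D by blast
  have decomp: "v = x \<odot>\<^bsub>icosa_lattice\<^esub> e1 \<oplus>\<^bsub>icosa_lattice\<^esub> y \<odot>\<^bsub>icosa_lattice\<^esub> e2 \<oplus>\<^bsub>icosa_lattice\<^esub> z \<odot>\<^bsub>icosa_lattice\<^esub> e3"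
    by (cases x; cases y; cases z)
      (simp add: v icosa_lattice_def e1_def e2_def e3_def golden_ring_def)
  have add: "\<rho> g (u \<oplus>\<^bsub>icosa_lattice\<^esub> w) = \<rho> g u \<oplus>\<^bsub>icosa_lattice\<^esub> \<rho> g w" if "g \<in> A5" for g u w
    using gmoduleD(1)[OF gm _ that] by simp
  have lin: "\<rho> g (r \<odot>\<^bsub>icosa_lattice\<^esub> u) = r \<odot>\<^bsub>icosa_lattice\<^esub> \<rho> g u" if "g \<in> A5" for g r u
    using D that by blast
  have act_v: "\<rho> g v = x \<odot>\<^bsub>icosa_lattice\<^esub> \<rho> g e1 \<oplus>\<^bsub>icosa_lattice\<^esub> y \<odot>\<^bsub>icosa_lattice\<^esub> \<rho> g e2 \<oplus>\<^bsub>icosa_lattice\<^esub> z \<odot>\<^bsub>icosa_lattice\<^esub> \<rho> g e3"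
    if "g \<in> A5" for g
    by (subst decomp) (simp only: add[OF that] lin[OF that])
  have neg: "\<ominus>\<^bsub>icosa_lattice\<^esub> ((a, b), (c, d), (e, f)) = ((- a, - b), (- c, - d), (- e, - f))" for a b c d e f
    by (rule M.minus_equality) (simp_all add: icosa_lattice_def golden_ring_def)
  show "\<rho> \<alpha> v = icosa_alpha v" 
    unfolding act_v[OF assms(2)] using D neg
    by (cases x; cases y; cases z)
      (simp add: v icosa_lattice_def e1_def e2_def e3_def golden_ring_def golden_phi_def)
  show "\<rho> \<gamma> v = icosa_gamma v" 
    unfolding act_v[OF assms(3)] using D
    by (cases x; cases y; cases z)
      (simp add: v icosa_lattice_def e1_def e2_def e3_def golden_ring_def golden_phi_def)
qed

lemma lattice_action_unique:
  assumes "icosa_generators \<alpha> \<gamma>" "icosa_lattice_action \<alpha> \<gamma> \<rho>" "icosa_lattice_action \<alpha> \<gamma> \<rho>'" "h \<in> A5"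
  shows "\<rho> h = \<rho>' h"
proof -
  have ag: "\<alpha> \<in> A5" "\<gamma> \<in> A5" using assms by (auto simp: icosa_generators_def)
  have gm: "gmodule Alt5 (add_monoid icosa_lattice) \<rho>" "gmodule Alt5 (add_monoid icosa_lattice) \<rho>'"
    using assms by (auto simp: icosa_lattice_action_def)
  note G = lattice_action_generators[OF assms(2) ag] lattice_action_generators[OF assms(3) ag]
  show ?thesis
    using assms(1,4)
  proof (induction rule: icosa_generators_induct)
    case id
    show ?case
      using gmoduleD(3)[OF gm(1) icosa_lattice_carrier(2)] gmoduleD(3)[OF gm(2) icosa_lattice_carrier(2)]
      by (intro ext) (simp only: alt5_one)
  next
    case (alpha h)
    have "\<rho> (\<alpha> \<otimes>\<^bsub>Alt5\<^esub> h) v = \<rho>' (\<alpha> \<otimes>\<^bsub>Alt5\<^esub> h) v" for v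
      using gmoduleD(2)[OF gm(1) icosa_lattice_carrier(2) ag(1) alpha.hyps]
        gmoduleD(2)[OF gm(2) icosa_lattice_carrier(2) ag(1) alpha.hyps] alpha.IH by (simp add: G)
    then show ?case by (intro ext) (simp only: alt5_mult)
  next
    case (gamma h)
    have "\<rho> (\<gamma> \<otimes>\<^bsub>Alt5\<^esub> h) v = \<rho>' (\<gamma> \<otimes>\<^bsub>Alt5\<^esub> h) v" for v
      using gmoduleD(2)[OF gm(1) icosa_lattice_carrier(2) ag(2) gamma.hyps]
        gmoduleD(2)[OF gm(2) icosa_lattice_carrier(2) ag(2) gamma.hyps] gamma.IH by (simp add: G)
    then show ?case by (intro ext) (simp only: alt5_mult)
  qed
qed

text \<open>The action is pulled back from the functions on the vertices along the injection
  \<open>heights\<close>. Its image is invariant under the generators, hence under the group; no relations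
  between the generators have to be checked.\<close>

definition icosa_action0 :: "(nat \<Rightarrow> nat) \<Rightarrow> golden \<times> golden \<times> golden \<Rightarrow> golden \<times> golden \<times> golden" where
  "icosa_action0 g v = (THE w. \<forall>p\<in>vertices0. heights w p = heights v (conj_by (inv' g) p))"

lemma conj_by_vertices0: "g \<in> A5 \<Longrightarrow> p \<in> vertices0 \<Longrightarrow> conj_by g p \<in> vertices0"
  using conj_class_eq[of p "alpha0 \<circ> gamma0"] unfolding conj_class0[symmetric]
  by (auto simp: conj_class_alt5)

lemma heights_icosa_action0:
  assumes "g \<in> A5" "p \<in> vertices0"
  shows "heights (icosa_action0 g v) p = heights v (conj_by (inv' g) p)"
proof -
  have "\<exists>w. \<forall>p\<in>vertices0. heights w p = heights v (conj_by (inv' g) p)"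
    using alpha0_gamma0_generators assms(1)
  proof (induction rule: icosa_generators_induct)
    case id
    show ?case by (rule exI[of _ v]) (simp add: conj_by_def)
  next
    case (alpha h)
    then obtain w where w: "\<forall>p\<in>vertices0. heights w p = heights v (conj_by (inv' h) p)" by blast
    have "heights (icosa_alpha w) p = heights v (conj_by (inv' (alpha0 \<circ> h)) p)" if p: "p \<in> vertices0" for p
    proof -
      have "conj_by (inv' (alpha0 \<circ> h)) p = conj_by (inv' h) (conj_by alpha0 p)"
        using alpha alpha0_in alt5_bij alt5_inv
        by (simp add: conj_by_conj_by o_inv_distrib inv_gen0)
      then show ?thesis
        using w conj_gen0_vertices0(1)[OF p] heights_alpha[OF p, of w]
        by (simp add: conj_by_def[of alpha0] inv_gen0)
    qed
    then show ?case by blast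
  next
    case (gamma h)
    then obtain w where w: "\<forall>p\<in>vertices0. heights w p = heights v (conj_by (inv' h) p)" by blast
    have "heights (icosa_gamma w) p = heights v (conj_by (inv' (gamma0 \<circ> h)) p)" if p: "p \<in> vertices0" for p
    proof -
      have "conj_by (inv' (gamma0 \<circ> h)) p = conj_by (inv' h) (conj_by (inv' gamma0) p)"
        using gamma gamma0_in alt5_bij alt5_inv
        by (simp add: conj_by_conj_by o_inv_distrib)
      moreover have "conj_by (inv' gamma0) p \<in> vertices0"
        by (rule conj_by_vertices0[OF alt5_inv[OF gamma0_in] p])
      moreover have "conj_by (inv' gamma0) p = gamma0 \<circ> gamma0 \<circ> p \<circ> gamma0"
        using inv_inv_eq[OF alt5_bij[OF gamma0_in]] by (simp add: conj_by_def inv_gen0)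
      ultimately show ?thesis
        using w heights_gamma[of w p] by simp
    qed
    then show ?case by blast
  qed
  then obtain w where w: "\<forall>p\<in>vertices0. heights w p = heights v (conj_by (inv' g) p)" by blast
  then have "icosa_action0 g v = w"
    unfolding icosa_action0_def by (intro the_equality) (auto intro: heights_eqD)
  then show ?thesis using w assms(2) by blast
qed

lemma icosa_action0_eqI:
  assumes "g \<in> A5" "\<And>p. p \<in> vertices0 \<Longrightarrow> heights w p = heights v (conj_by (inv' g) p)"
  shows "icosa_action0 g v = w"
  by (rule heights_eqD) (simp add: assms heights_icosa_action0)

lemma icosa_action0_lattice_action: "icosa_lattice_action alpha0 gamma0 icosa_action0"
proof -
  interpret M: module golden_ring icosa_lattice by (rule module_icosa_lattice)
  have ea: "icosa_action0 alpha0 v = icosa_alpha v" for v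
    by (rule icosa_action0_eqI[OF alpha0_in]) (simp add: heights_alpha conj_by_def inv_gen0)
  have eg: "icosa_action0 gamma0 v = icosa_gamma v" for v
    using inv_inv_eq[OF alt5_bij[OF gamma0_in]]
    by (intro icosa_action0_eqI[OF gamma0_in]) (simp add: heights_gamma conj_by_def inv_gen0)
  have neg: "\<ominus>\<^bsub>icosa_lattice\<^esub> ((a, b), (c, d), (e, f)) = ((- a, - b), (- c, - d), (- e, - f))" for a b c d e f
    by (rule M.minus_equality) (simp_all add: icosa_lattice_def golden_ring_def)
  have gm: "gmodule Alt5 (add_monoid icosa_lattice) icosa_action0"
  proof (rule gmoduleI)
    show "comm_group (add_monoid icosa_lattice)"
      using M.a_comm_group .
  next
    fix g v w assume g: "g \<in> A5"
    show "icosa_action0 g (v \<otimes>\<^bsub>add_monoid icosa_lattice\<^esub> w)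
      = icosa_action0 g v \<otimes>\<^bsub>add_monoid icosa_lattice\<^esub> icosa_action0 g w"
      using g by (intro icosa_action0_eqI) (simp_all add: heights_add heights_icosa_action0)
  next
    fix g h v assume gh: "g \<in> A5" "h \<in> A5"
    show "icosa_action0 (g \<otimes>\<^bsub>Alt5\<^esub> h) v = icosa_action0 g (icosa_action0 h v)"
      using gh alt5_comp alt5_inv alt5_bij
      by (intro icosa_action0_eqI)
        (simp_all add: heights_icosa_action0 conj_by_vertices0 conj_by_conj_by o_inv_distrib)
  next
    show "icosa_action0 \<one>\<^bsub>Alt5\<^esub> v = v" for v
      using alt5_id by (intro icosa_action0_eqI) (simp_all add: conj_by_def)
  qed (simp_all add: alt5_group)
  have "icosa_action0 g (r \<odot>\<^bsub>icosa_lattice\<^esub> v) = r \<odot>\<^bsub>icosa_lattice\<^esub> icosa_action0 g v" if "g \<in> A5" for g r v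
    using that by (intro icosa_action0_eqI) (simp_all add: heights_smult heights_icosa_action0)
  then show ?thesis
    unfolding icosa_lattice_action_def
    using gm neg unfolding ea eg
    by (simp add: e1_def e2_def e3_def golden_ring_def golden_phi_def)
      (simp add: icosa_lattice_def golden_ring_def)
qed

text \<open>The standard action, precomposed with the relabelling of the generators, is an action for
  \<open>\<alpha>\<close> and \<open>\<gamma>\<close>; by uniqueness it is the one chosen by \<open>icosa_action\<close>.\<close>

lemma icosa_action_lattice_action:
  assumes "icosa_generators \<alpha> \<gamma>"
  shows "icosa_lattice_action \<alpha> \<gamma> (icosa_action \<alpha> \<gamma>)"
proof -
  obtain x where x: "x permutes {1..5}" "\<alpha> = conj_by x alpha0" "\<gamma> = conj_by x gamma0"
    using icosa_generators_conj_standard[OF assms] .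
  note b = permutes_bij[OF x(1)]
  let ?c = "conj_by (inv' x)"
  have c: "?c g \<in> A5" if "g \<in> A5" for g
    using conj_by_in_alt5[OF permutes_inv[OF x(1)] that] .
  have gm0: "gmodule Alt5 (add_monoid icosa_lattice) icosa_action0"
    using icosa_action0_lattice_action by (simp add: icosa_lattice_action_def)
  define \<rho> where "\<rho> = (\<lambda>g\<in>A5. icosa_action0 (?c g))"
  have "gmodule Alt5 (add_monoid icosa_lattice) \<rho>"
  proof (rule gmoduleI)
    show "comm_group (add_monoid icosa_lattice)"
      using gm0 by (simp add: gmodule_def)
  next
    fix g v w assume g: "g \<in> A5"
    show "\<rho> g (v \<otimes>\<^bsub>add_monoid icosa_lattice\<^esub> w)
      = \<rho> g v \<otimes>\<^bsub>add_monoid icosa_lattice\<^esub> \<rho> g w"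
      using gmoduleD(1)[OF gm0 _ c[OF g]] g by (simp add: \<rho>_def)
  next
    fix g h v assume gh: "g \<in> A5" "h \<in> A5"
    show "\<rho> (g \<otimes>\<^bsub>Alt5\<^esub> h) v = \<rho> g (\<rho> h v)"
      using gmoduleD(2)[OF gm0 _ c[OF gh(1)] c[OF gh(2)], of v] gh alt5_comp[OF gh]
      by (simp add: \<rho>_def conj_by_comp bij_imp_bij_inv b)
  next
    show "\<rho> \<one>\<^bsub>Alt5\<^esub> v = v" for v
      using gmoduleD(3)[OF gm0, of v] alt5_id by (simp add: \<rho>_def conj_by_id[OF bij_imp_bij_inv[OF b]])
  qed (simp_all add: alt5_group)
  moreover have "\<rho> \<alpha> = icosa_action0 alpha0" "\<rho> \<gamma> = icosa_action0 gamma0"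
    using x conj_by_in_alt5[OF x(1)] alpha0_in gamma0_in by (simp_all add: \<rho>_def conj_by_inverse[OF b])
  ultimately have L: "icosa_lattice_action \<alpha> \<gamma> \<rho>"
    using icosa_action0_lattice_action c by (simp add: icosa_lattice_action_def \<rho>_def)
  have "icosa_action \<alpha> \<gamma> = \<rho>"
    unfolding icosa_action_def
  proof (rule the_equality)
    show "\<rho> \<in> extensional A5 \<and> icosa_lattice_action \<alpha> \<gamma> \<rho>"
      using L by (simp add: \<rho>_def)
  next
    fix \<rho>' assume "\<rho>' \<in> extensional A5 \<and> icosa_lattice_action \<alpha> \<gamma> \<rho>'"
    then show "\<rho>' = \<rho>"
      using lattice_action_unique[OF assms _ L] by (intro extensionalityI[of _ A5]) (auto simp: \<rho>_def)
  qed
  then show ?thesis using L by simp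
qed

section \<open>Identifying the tensor product\<close>

lemma tensor_free_simps [simp]:
  "c \<in> carrier (tensor_free M N) \<longleftrightarrow> Poly_Mapping.keys c \<subseteq> carrier M \<times> carrier N"
  "c \<otimes>\<^bsub>tensor_free M N\<^esub> d = c + d" "\<one>\<^bsub>tensor_free M N\<^esub> = 0"
  by (simp_all add: tensor_free_def)

lemma tensor_free_comm_group: "comm_group (tensor_free M N)"
  unfolding tensor_free_def by (rule abelian_free_Abelian_group)

lemma keys_diff_subset:
  fixes a b :: "'k \<Rightarrow>\<^sub>0 int"
  shows "Poly_Mapping.keys a \<subseteq> S \<Longrightarrow> Poly_Mapping.keys b \<subseteq> S \<Longrightarrow> Poly_Mapping.keys (a - b) \<subseteq> S"
  using keys_diff[of a b] by blast

lemma tensor_relations_carrier: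
  assumes "module R M" "module R N"
  shows "tensor_relations R M N \<subseteq> carrier (tensor_free M N)"
proof -
  interpret M: module R M by fact
  interpret N: module R N by fact
  have "c \<in> carrier (tensor_free M N)" if "c \<in> tensor_relations R M N" for c
    proof -
      from that consider
          x y n where "c = frag_of (x \<oplus>\<^bsub>M\<^esub> y, n) - frag_of (x, n) - frag_of (y, n)"
            "x \<in> carrier M" "y \<in> carrier M" "n \<in> carrier N"
        | x m n where "c = frag_of (x, m \<oplus>\<^bsub>N\<^esub> n) - frag_of (x, m) - frag_of (x, n)"
            "x \<in> carrier M" "m \<in> carrier N" "n \<in> carrier N"
        | r x n where "c = frag_of (r \<odot>\<^bsub>M\<^esub> x, n) - frag_of (x, r \<odot>\<^bsub>N\<^esub> n)"
            "r \<in> carrier R" "x \<in> carrier M" "n \<in> carrier N"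
        unfolding tensor_relations_def by blast
      then have "Poly_Mapping.keys c \<subseteq> carrier M \<times> carrier N"
      proof cases
        case 1
        show ?thesis unfolding 1(1) by (intro keys_diff_subset) (simp_all add: 1)
      next
        case 2
        show ?thesis unfolding 2(1) by (intro keys_diff_subset) (simp_all add: 2)
      next
        case 3
        show ?thesis unfolding 3(1) by (intro keys_diff_subset) (simp_all add: 3)
      qed
      then show ?thesis by simp
    qed
  then show ?thesis by blast
qed

lemma tensor_kernel_subgroup:
  assumes "module R M" "module R N"
  shows "subgroup (tensor_kernel R M N) (tensor_free M N)"
  unfolding tensor_kernel_def
  by (rule group.generate_is_subgroup)
    (simp_all add: comm_group.axioms(2) tensor_free_comm_group tensor_relations_carrier assms)

lemma tensor_kernel_closed:
  assumes "module R M" "module R N" "c \<in> tensor_kernel R M N" "d \<in> tensor_kernel R M N"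
  shows "c + d \<in> tensor_kernel R M N" "- c \<in> tensor_kernel R M N" "c - d \<in> tensor_kernel R M N"
proof -
  note S = tensor_kernel_subgroup[OF assms(1,2)]
  have m: "- c \<in> tensor_kernel R M N" if "c \<in> tensor_kernel R M N" for c
    using subgroup.m_inv_closed[OF S that] subgroup.subset[OF S] that by (auto simp: tensor_free_def)
  have a: "c + d \<in> tensor_kernel R M N" if "c \<in> tensor_kernel R M N" "d \<in> tensor_kernel R M N" for c d
    using subgroup.m_closed[OF S that] by simp
  show "c + d \<in> tensor_kernel R M N" "- c \<in> tensor_kernel R M N" "c - d \<in> tensor_kernel R M N"
    using m a assms(3,4) by (simp_all, metis add_uminus_conv_diff)
qed

lemma tensor_kernel_relations:
  shows "x \<in> carrier M \<Longrightarrow> y \<in> carrier M \<Longrightarrow> n \<in> carrier N \<Longrightarrow>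
      frag_of (x \<oplus>\<^bsub>M\<^esub> y, n) - frag_of (x, n) - frag_of (y, n) \<in> tensor_kernel R M N"
    and "x \<in> carrier M \<Longrightarrow> m \<in> carrier N \<Longrightarrow> n \<in> carrier N \<Longrightarrow>
      frag_of (x, m \<oplus>\<^bsub>N\<^esub> n) - frag_of (x, m) - frag_of (x, n) \<in> tensor_kernel R M N"
    and "r \<in> carrier R \<Longrightarrow> x \<in> carrier M \<Longrightarrow> n \<in> carrier N \<Longrightarrow>
      frag_of (r \<odot>\<^bsub>M\<^esub> x, n) - frag_of (x, r \<odot>\<^bsub>N\<^esub> n) \<in> tensor_kernel R M N"
proof -
  have *: "c \<in> tensor_relations R M N \<Longrightarrow> c \<in> tensor_kernel R M N" for c
    unfolding tensor_kernel_def by (rule generate.incl)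
  show "x \<in> carrier M \<Longrightarrow> y \<in> carrier M \<Longrightarrow> n \<in> carrier N \<Longrightarrow>
      frag_of (x \<oplus>\<^bsub>M\<^esub> y, n) - frag_of (x, n) - frag_of (y, n) \<in> tensor_kernel R M N"
    by (rule *) (unfold tensor_relations_def, blast)
  show "x \<in> carrier M \<Longrightarrow> m \<in> carrier N \<Longrightarrow> n \<in> carrier N \<Longrightarrow>
      frag_of (x, m \<oplus>\<^bsub>N\<^esub> n) - frag_of (x, m) - frag_of (x, n) \<in> tensor_kernel R M N"
    by (rule *) (unfold tensor_relations_def, blast)
  show "r \<in> carrier R \<Longrightarrow> x \<in> carrier M \<Longrightarrow> n \<in> carrier N \<Longrightarrow>
      frag_of (r \<odot>\<^bsub>M\<^esub> x, n) - frag_of (x, r \<odot>\<^bsub>N\<^esub> n) \<in> tensor_kernel R M N"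
    by (rule *) (unfold tensor_relations_def, blast)
qed

lemma tensor_zero_right:
  assumes "module R M" "module R N" "x \<in> carrier M"
  shows "frag_of (x, \<zero>\<^bsub>N\<^esub>) \<in> tensor_kernel R M N"
proof -
  interpret N: module R N by fact
  note zero = subgroup.one_closed[OF tensor_kernel_subgroup[OF assms(1,2)], simplified]
  have "- frag_of (x, \<zero>\<^bsub>N\<^esub>) \<in> tensor_kernel R M N"
    using tensor_kernel_relations(2)[OF assms(3) N.zero_closed N.zero_closed, of R] by simp
  from tensor_kernel_closed(2)[OF assms(1,2) this zero] show ?thesis by simp
qed

lemma lattice_decomposition:
  "(x, y, z) = x \<odot>\<^bsub>icosa_lattice\<^esub> e1 \<oplus>\<^bsub>icosa_lattice\<^esub> (y \<odot>\<^bsub>icosa_lattice\<^esub> e2 \<oplus>\<^bsub>icosa_lattice\<^esub> z \<odot>\<^bsub>icosa_lattice\<^esub> e3)"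
  by (cases x; cases y; cases z)
    (simp add: icosa_lattice_def e1_def e2_def e3_def golden_ring_def)

lemma golden_carrier [simp]: "carrier golden_ring = UNIV"
  by (simp add: golden_ring_def)

text \<open>Since \<open>e1\<close>, \<open>e2\<close>, \<open>e3\<close> generate the lattice, the relations move all scalars to the
  right-hand factor.\<close>

lemma tensor_icosa_normal_form:
  fixes M :: "(golden, 'l) module"
  assumes M: "module golden_ring M"
    and c: "c \<in> carrier (tensor_free icosa_lattice M)"
  shows "\<exists>m1 \<in> carrier M. \<exists>m2 \<in> carrier M. \<exists>m3 \<in> carrier M.
    c - (frag_of (e1, m1) + frag_of (e2, m2) + frag_of (e3, m3)) \<in> tensor_kernel golden_ring icosa_lattice M"
proof -
  interpret M: module golden_ring M by fact
  let ?K = "tensor_kernel golden_ring icosa_lattice M"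
  note closed = tensor_kernel_closed[OF module_icosa_lattice M]
  note rel = tensor_kernel_relations[where R = golden_ring and M = icosa_lattice and N = M, simplified]
  let ?n = "\<lambda>a b d. frag_of (e1, a) + frag_of (e2, b) + frag_of (e3, d)"
  have kdiff: "frag_of (x, m) - frag_of (x, n) - frag_of (x, m \<ominus>\<^bsub>M\<^esub> n) \<in> ?K"
    if "m \<in> carrier M" "n \<in> carrier M" for x m n
    using rel(2)[of "m \<ominus>\<^bsub>M\<^esub> n" n x] that
    by (simp add: M.minus_eq M.a_assoc M.l_neg algebra_simps)
  have "Poly_Mapping.keys c \<subseteq> carrier icosa_lattice \<times> carrier M" using c by simp
  then show ?thesis
  proof (induction rule: frag_induction)
    case zero
    have z: "frag_of (x, \<zero>\<^bsub>M\<^esub>) \<in> ?K" for x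
      by (rule tensor_zero_right[OF module_icosa_lattice M]) simp
    have "0 - ?n \<zero>\<^bsub>M\<^esub> \<zero>\<^bsub>M\<^esub> \<zero>\<^bsub>M\<^esub> \<in> ?K"
      unfolding diff_0 by (rule closed(2)[OF closed(1)[OF closed(1)[OF z z] z] z])
    then show ?case by blast
  next
    case (one xm)
    obtain x y z m where xm: "xm = ((x, y, z), m)" by (metis surj_pair)
    then have m: "m \<in> carrier M" using one by simp
    have "frag_of ((x, y, z), m) - ?n (x \<odot>\<^bsub>M\<^esub> m) (y \<odot>\<^bsub>M\<^esub> m) (z \<odot>\<^bsub>M\<^esub> m) =
      (frag_of ((x, y, z), m) - frag_of (x \<odot>\<^bsub>icosa_lattice\<^esub> e1, m)
        - frag_of (y \<odot>\<^bsub>icosa_lattice\<^esub> e2 \<oplus>\<^bsub>icosa_lattice\<^esub> z \<odot>\<^bsub>icosa_lattice\<^esub> e3, m)) +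
      (frag_of (y \<odot>\<^bsub>icosa_lattice\<^esub> e2 \<oplus>\<^bsub>icosa_lattice\<^esub> z \<odot>\<^bsub>icosa_lattice\<^esub> e3, m)
        - frag_of (y \<odot>\<^bsub>icosa_lattice\<^esub> e2, m) - frag_of (z \<odot>\<^bsub>icosa_lattice\<^esub> e3, m)) +
      ((frag_of (x \<odot>\<^bsub>icosa_lattice\<^esub> e1, m) - frag_of (e1, x \<odot>\<^bsub>M\<^esub> m)) +
       (frag_of (y \<odot>\<^bsub>icosa_lattice\<^esub> e2, m) - frag_of (e2, y \<odot>\<^bsub>M\<^esub> m)) +
       (frag_of (z \<odot>\<^bsub>icosa_lattice\<^esub> e3, m) - frag_of (e3, z \<odot>\<^bsub>M\<^esub> m)))"
      by (simp add: algebra_simps)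
    also have "\<dots> \<in> ?K"
      unfolding lattice_decomposition[of x y z] by (intro closed(1) rel m)
    finally have "\<exists>m3 \<in> carrier M. frag_of ((x, y, z), m) - ?n (x \<odot>\<^bsub>M\<^esub> m) (y \<odot>\<^bsub>M\<^esub> m) m3 \<in> ?K"
      using m by - (rule bexI[where x = "z \<odot>\<^bsub>M\<^esub> m"], simp_all)
    then have "\<exists>m2 \<in> carrier M. \<exists>m3 \<in> carrier M. frag_of ((x, y, z), m) - ?n (x \<odot>\<^bsub>M\<^esub> m) m2 m3 \<in> ?K"
      using m by - (rule bexI[where x = "y \<odot>\<^bsub>M\<^esub> m"], simp_all)
    then show ?case
      unfolding xm using m by - (rule bexI[where x = "x \<odot>\<^bsub>M\<^esub> m"], simp_all)
  next
    case (diff a b)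
    then obtain a1 a2 a3 b1 b2 b3 where ab: "a1 \<in> carrier M" "a2 \<in> carrier M" "a3 \<in> carrier M"
      "b1 \<in> carrier M" "b2 \<in> carrier M" "b3 \<in> carrier M"
      "a - ?n a1 a2 a3 \<in> ?K" "b - ?n b1 b2 b3 \<in> ?K" by blast
    have "a - b - ?n (a1 \<ominus>\<^bsub>M\<^esub> b1) (a2 \<ominus>\<^bsub>M\<^esub> b2) (a3 \<ominus>\<^bsub>M\<^esub> b3) =
       (a - ?n a1 a2 a3) - (b - ?n b1 b2 b3)
       + ((frag_of (e1, a1) - frag_of (e1, b1) - frag_of (e1, a1 \<ominus>\<^bsub>M\<^esub> b1))
       + (frag_of (e2, a2) - frag_of (e2, b2) - frag_of (e2, a2 \<ominus>\<^bsub>M\<^esub> b2))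
       + (frag_of (e3, a3) - frag_of (e3, b3) - frag_of (e3, a3 \<ominus>\<^bsub>M\<^esub> b3)))"
      by (simp add: algebra_simps)
    also have "\<dots> \<in> ?K"
      by (intro closed ab kdiff)
    finally show ?case
      using M.minus_closed[OF ab(1,4)] M.minus_closed[OF ab(2,5)] M.minus_closed[OF ab(3,6)] by blast
  qed
qed

text \<open>The map \<open>E\<close> is a coordinate system of \<open>V\<close> with values in \<open>M\<close> in which the generators act
  by the matrices of the lattice. It induces a balanced map \<open>((x, y, z), m) \<mapsto> E (x m) (y m) (z m)\<close>
  and so a homomorphism \<open>\<Psi>\<close> from the free abelian group onto \<open>V\<close>. By the normal form and the
  injectivity of \<open>E\<close>, the kernel of \<open>\<Psi>\<close> is precisely the subgroup of relations, so \<open>\<Psi>\<close> descends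
  to an isomorphism.\<close>

lemma Icosa_isomorphic:
  fixes act :: "(nat \<Rightarrow> nat) \<Rightarrow> 'v::ab_group_add \<Rightarrow> 'v" and M :: "(golden, 'l) module"
    and E :: "'l \<Rightarrow> 'l \<Rightarrow> 'l \<Rightarrow> 'v"
  assumes M: "module golden_ring M"
    and gm: "gmodule Alt5 (add_group :: 'v monoid) act"
    and gens: "icosa_generators \<alpha> \<gamma>"
    and add: "\<And>a b c a' b' c'. \<lbrakk>a \<in> carrier M; b \<in> carrier M; c \<in> carrier M;
        a' \<in> carrier M; b' \<in> carrier M; c' \<in> carrier M\<rbrakk> \<Longrightarrow>
        E (a \<oplus>\<^bsub>M\<^esub> a') (b \<oplus>\<^bsub>M\<^esub> b') (c \<oplus>\<^bsub>M\<^esub> c') = E a b c + E a' b' c'"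
    and inj: "\<And>a b c. \<lbrakk>a \<in> carrier M; b \<in> carrier M; c \<in> carrier M; E a b c = 0\<rbrakk> \<Longrightarrow>
        a = \<zero>\<^bsub>M\<^esub> \<and> b = \<zero>\<^bsub>M\<^esub> \<and> c = \<zero>\<^bsub>M\<^esub>"
    and surj: "\<And>v. \<exists>a \<in> carrier M. \<exists>b \<in> carrier M. \<exists>c \<in> carrier M. v = E a b c"
    and act_alpha: "\<And>a b c. \<lbrakk>a \<in> carrier M; b \<in> carrier M; c \<in> carrier M\<rbrakk> \<Longrightarrow>
        act \<alpha> (E a b c) = E (\<ominus>\<^bsub>M\<^esub> a) (\<ominus>\<^bsub>M\<^esub> b) (c \<oplus>\<^bsub>M\<^esub> golden_phi \<odot>\<^bsub>M\<^esub> (a \<oplus>\<^bsub>M\<^esub> b))"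
    and act_gamma: "\<And>a b c. \<lbrakk>a \<in> carrier M; b \<in> carrier M; c \<in> carrier M\<rbrakk> \<Longrightarrow>
        act \<gamma> (E a b c) = E b c a"
  shows "gmodule_isomorphic Alt5 (add_group :: 'v monoid) act (Icosa M) (Icosa_act \<alpha> \<gamma> M)"
proof -
  interpret M: module golden_ring M by fact
  interpret L: module golden_ring icosa_lattice by (rule module_icosa_lattice)
  interpret V: additive_gmodule Alt5 act
    by (intro additive_gmodule.intro additive_gmodule_axioms.intro alt5_group gm)
  let ?F = "tensor_free icosa_lattice M"
  let ?K = "tensor_kernel golden_ring icosa_lattice M"
  let ?\<rho> = "icosa_action \<alpha> \<gamma>"
  have ag: "\<alpha> \<in> A5" "\<gamma> \<in> A5" using gens by (auto simp: icosa_generators_def)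
  note \<rho> = icosa_action_lattice_action[OF gens]
  note \<rho>_gm = \<rho>[unfolded icosa_lattice_action_def, THEN conjunct1]
  define \<psi> where "\<psi> = (\<lambda>((x, y, z), m). E (x \<odot>\<^bsub>M\<^esub> m) (y \<odot>\<^bsub>M\<^esub> m) (z \<odot>\<^bsub>M\<^esub> m))"
  have \<psi>: "\<psi> ((x, y, z), m) = E (x \<odot>\<^bsub>M\<^esub> m) (y \<odot>\<^bsub>M\<^esub> m) (z \<odot>\<^bsub>M\<^esub> m)" for x y z m
    by (simp add: \<psi>_def)
  have lat: "(x, y, z) \<oplus>\<^bsub>icosa_lattice\<^esub> (x', y', z') =
      (x \<oplus>\<^bsub>golden_ring\<^esub> x', y \<oplus>\<^bsub>golden_ring\<^esub> y', z \<oplus>\<^bsub>golden_ring\<^esub> z')"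
    "r \<odot>\<^bsub>icosa_lattice\<^esub> (x, y, z) = (r \<otimes>\<^bsub>golden_ring\<^esub> x, r \<otimes>\<^bsub>golden_ring\<^esub> y, r \<otimes>\<^bsub>golden_ring\<^esub> z)"
    for x y z x' y' z' r
    by (simp_all add: icosa_lattice_def)
  interpret A: comm_group "add_group :: 'v monoid" by (rule comm_group_add_group)
  obtain \<Psi> where \<Psi>: "\<Psi> \<in> hom ?F (add_group :: 'v monoid)"
    and \<Psi>_of: "\<And>x. x \<in> carrier icosa_lattice \<times> carrier M \<Longrightarrow> \<Psi> (frag_of x) = \<psi> x"
    using A.free_Abelian_group_universal[of \<psi> "carrier icosa_lattice \<times> carrier M"]
    unfolding tensor_free_def by auto
  interpret H: group_hom ?F "add_group :: 'v monoid" \<Psi>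
    by (intro group_hom.intro group_hom_axioms.intro \<Psi> comm_group.axioms(2) tensor_free_comm_group
        comm_group_add_group)
  have \<Psi>_frag: "\<Psi> (frag_of (x, m)) = \<psi> (x, m)" if "m \<in> carrier M" for x m
    using \<Psi>_of that by simp
  have \<Psi>_add: "\<Psi> (c + d) = \<Psi> c + \<Psi> d" if "c \<in> carrier ?F" "d \<in> carrier ?F" for c d
    using H.hom_mult[OF that] by simp
  have \<Psi>_diff: "\<Psi> (c - d) = \<Psi> c - \<Psi> d" if "c \<in> carrier ?F" "d \<in> carrier ?F" for c d
  proof -
    have "c - d \<in> carrier ?F" using that keys_diff[of c d] by auto
    then show ?thesis using \<Psi>_add[of "c - d" d] that by simp
  qed
  have frag_in: "frag_of (x, m) \<in> carrier ?F" if "m \<in> carrier M" for x m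
    using that by simp
  have diff_in: "c - d \<in> carrier ?F" if "c \<in> carrier ?F" "d \<in> carrier ?F" for c d
    using that keys_diff[of c d] by auto
  have add_in: "c + d \<in> carrier ?F" if "c \<in> carrier ?F" "d \<in> carrier ?F" for c d
    using that keys_add[of c d] by auto
  note \<Psi>_simps = \<Psi>_frag \<Psi>_add \<Psi>_diff frag_in diff_in add_in
  have ker_sub: "?K \<subseteq> kernel ?F add_group \<Psi>"
    unfolding tensor_kernel_def
  proof (rule H.generate_subgroup_incl[OF _ H.subgroup_kernel], rule subsetI)
    fix c assume c: "c \<in> tensor_relations golden_ring icosa_lattice M"
    then have cF: "c \<in> carrier ?F"
      using tensor_relations_carrier[OF module_icosa_lattice M] by blast
    from c consider
        (left) x y m where "c = frag_of (x \<oplus>\<^bsub>icosa_lattice\<^esub> y, m) - frag_of (x, m) - frag_of (y, m)" "m \<in> carrier M"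
      | (right) x m n where "c = frag_of (x, m \<oplus>\<^bsub>M\<^esub> n) - frag_of (x, m) - frag_of (x, n)" "m \<in> carrier M" "n \<in> carrier M"
      | (balance) r x m where "c = frag_of (r \<odot>\<^bsub>icosa_lattice\<^esub> x, m) - frag_of (x, r \<odot>\<^bsub>M\<^esub> m)" "m \<in> carrier M"
      unfolding tensor_relations_def by blast
    then have "\<Psi> c = 0"
    proof cases
      case left
      obtain x1 x2 x3 y1 y2 y3 where xy: "x = (x1, x2, x3)" "y = (y1, y2, y3)" by (metis surj_pair)
      show ?thesis
        using left by (simp add: \<Psi>_simps xy lat \<psi> M.smult_l_distr add del: tensor_free_simps)
    next
      case right
      obtain x1 x2 x3 where x: "x = (x1, x2, x3)" by (metis surj_pair)
      show ?thesis
        using right by (simp add: \<Psi>_simps x \<psi> M.smult_r_distr add del: tensor_free_simps)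
    next
      case balance
      obtain x1 x2 x3 where x: "x = (x1, x2, x3)" by (metis surj_pair)
      have "(r \<otimes>\<^bsub>golden_ring\<^esub> y) \<odot>\<^bsub>M\<^esub> m = y \<odot>\<^bsub>M\<^esub> (r \<odot>\<^bsub>M\<^esub> m)" for y
        using balance(2) M.smult_assoc1[of y r m] M.R.m_comm[of r y] by simp
      then show ?thesis
        using balance by (simp add: \<Psi>_simps x lat \<psi> del: tensor_free_simps)
    qed
    then show "c \<in> kernel ?F add_group \<Psi>" using cF by (simp add: kernel_def)
  qed
  let ?n = "\<lambda>a b d. frag_of (e1, a) + frag_of (e2, b) + frag_of (e3, d)"
  have n_in: "?n a b d \<in> carrier ?F" if "a \<in> carrier M" "b \<in> carrier M" "d \<in> carrier M" for a b d
    using that by (intro add_in frag_in)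
  have \<Psi>_n: "\<Psi> (?n a b d) = E a b d" if m: "a \<in> carrier M" "b \<in> carrier M" "d \<in> carrier M" for a b d
  proof -
    have one: "(1, 0) \<odot>\<^bsub>M\<^esub> l = l" and zero: "(0, 0) \<odot>\<^bsub>M\<^esub> l = \<zero>\<^bsub>M\<^esub>" if "l \<in> carrier M" for l
      using M.smult_one[OF that] M.smult_l_null[OF that] by (simp_all add: golden_ring_def)
    have "\<Psi> (?n a b d) = E a \<zero>\<^bsub>M\<^esub> \<zero>\<^bsub>M\<^esub> + E \<zero>\<^bsub>M\<^esub> b \<zero>\<^bsub>M\<^esub> + E \<zero>\<^bsub>M\<^esub> \<zero>\<^bsub>M\<^esub> d"
      using m by (simp add: \<Psi>_simps e1_def e2_def e3_def golden_ring_def \<psi> one zero del: tensor_free_simps)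
    also have "\<dots> = E a b d"
      using m by (simp flip: add)
    finally show ?thesis .
  qed
  have ker: "kernel ?F add_group \<Psi> = ?K"
  proof (intro equalityI ker_sub subsetI)
    fix c assume c: "c \<in> kernel ?F add_group \<Psi>"
    then have cF: "c \<in> carrier ?F" and c0: "\<Psi> c = 0" by (simp_all add: kernel_def)
    obtain a b d where m: "a \<in> carrier M" "b \<in> carrier M" "d \<in> carrier M" and k: "c - ?n a b d \<in> ?K"
      using tensor_icosa_normal_form[OF M cF] by blast
    have "\<Psi> (c - ?n a b d) = 0"
      using k ker_sub by (auto simp: kernel_def)
    then have "E a b d = 0"
      using \<Psi>_diff[OF cF n_in[OF m]] c0 \<Psi>_n[OF m] by simp
    from inj[OF m this] have z: "a = \<zero>\<^bsub>M\<^esub>" "b = \<zero>\<^bsub>M\<^esub>" "d = \<zero>\<^bsub>M\<^esub>" by simp_all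
    note closed = tensor_kernel_closed[OF module_icosa_lattice M]
    have f: "frag_of (x, \<zero>\<^bsub>M\<^esub>) \<in> ?K" for x
      by (rule tensor_zero_right[OF module_icosa_lattice M]) simp
    have "(c - ?n a b d) + ?n a b d \<in> ?K"
      by (rule closed(1)[OF k], unfold z) (intro closed(1) f)
    then show "c \<in> ?K" by simp
  qed
  have \<Psi>_surj: "\<Psi> ` carrier ?F = carrier (add_group :: 'v monoid)"
  proof -
    have "v \<in> \<Psi> ` carrier ?F" for v
      using surj[of v] n_in \<Psi>_n by (metis image_eqI)
    then show ?thesis by auto
  qed
  let ?h = "\<lambda>S. the_elem (\<Psi> ` S)"
  have iso: "?h \<in> iso (Icosa M) (add_group :: 'v monoid)"
    using H.FactGroup_iso_set[OF \<Psi>_surj] unfolding ker Icosa_def tensor_product_def by blast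
  \<comment> \<open>The balanced map is equivariant, because it is so for the generators.\<close>
  have \<psi>_equiv: "\<psi> (?\<rho> g x, m) = act g (\<psi> (x, m))" if g: "g \<in> A5" and m: "m \<in> carrier M" for g x m
    using gens g
  proof (induction rule: icosa_generators_induct)
    case id
    show ?case
      using gmoduleD(3)[OF \<rho>_gm icosa_lattice_carrier(2), of x] V.act_one by (simp only: alt5_one)
  next
    case (alpha h)
    have *: "\<psi> (icosa_alpha u, m) = act \<alpha> (\<psi> (u, m))" for u
    proof -
      obtain a b c d e f where u: "u = ((a, b), (c, d), (e, f))" by (metis surj_pair)
      have neg: "(- i, - j) \<odot>\<^bsub>M\<^esub> m = \<ominus>\<^bsub>M\<^esub> ((i, j) \<odot>\<^bsub>M\<^esub> m)" for i j
      proof -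
        have "\<ominus>\<^bsub>golden_ring\<^esub> (i, j) = (- i, - j)"
          by (rule M.R.minus_equality) (simp_all add: golden_ring_def)
        then show ?thesis using M.smult_l_minus[of "(i, j)" m] m by simp
      qed
      have "(e + b + d, f + a + b + c + d)
        = (e, f) \<oplus>\<^bsub>golden_ring\<^esub> golden_phi \<otimes>\<^bsub>golden_ring\<^esub> ((a, b) \<oplus>\<^bsub>golden_ring\<^esub> (c, d))"
        by (simp add: golden_ring_def golden_phi_def)
      then have "(e + b + d, f + a + b + c + d) \<odot>\<^bsub>M\<^esub> m
        = (e, f) \<odot>\<^bsub>M\<^esub> m \<oplus>\<^bsub>M\<^esub> golden_phi \<odot>\<^bsub>M\<^esub> ((a, b) \<odot>\<^bsub>M\<^esub> m \<oplus>\<^bsub>M\<^esub> (c, d) \<odot>\<^bsub>M\<^esub> m)"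
        using m by (simp add: M.smult_l_distr M.smult_assoc1)
      then show ?thesis using m by (simp add: u \<psi> act_alpha neg)
    qed
    show ?case
      using * alpha.IH gmoduleD(2)[OF \<rho>_gm icosa_lattice_carrier(2) ag(1) alpha.hyps, of x]
        V.act_mult[OF ag(1) alpha.hyps] lattice_action_generators(1)[OF \<rho> ag]
      by (simp only: alt5_mult)
  next
    case (gamma h)
    have *: "\<psi> (icosa_gamma u, m) = act \<gamma> (\<psi> (u, m))" for u
    proof -
      obtain a b c where u: "u = (a, b, c)" by (metis surj_pair)
      show ?thesis using m by (simp add: u \<psi> act_gamma)
    qed
    show ?case
      using * gamma.IH gmoduleD(2)[OF \<rho>_gm icosa_lattice_carrier(2) ag(2) gamma.hyps, of x]
        V.act_mult[OF ag(2) gamma.hyps] lattice_action_generators(2)[OF \<rho> ag]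
      by (simp only: alt5_mult)
  qed
  define ext where "ext = (\<lambda>g. frag_extend (\<lambda>(x, m). frag_of (?\<rho> g x, m)) :: _ \<Rightarrow> (golden \<times> golden \<times> golden) \<times> 'l \<Rightarrow>\<^sub>0 int)"
  have ext_of: "ext g (frag_of (x, m)) = frag_of (?\<rho> g x, m)" for g x m
    by (simp add: ext_def)
  have ext_in: "ext g c \<in> carrier ?F \<and> \<Psi> (ext g c) = act g (\<Psi> c)" if g: "g \<in> A5" and c: "c \<in> carrier ?F" for g c
  proof -
    have "Poly_Mapping.keys c \<subseteq> carrier icosa_lattice \<times> carrier M" using c by simp
    then have "c \<in> carrier ?F \<and> ext g c \<in> carrier ?F \<and> \<Psi> (ext g c) = act g (\<Psi> c)"
    proof (induction rule: frag_induction)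
      case zero
      then show ?case using H.hom_one by (simp add: ext_def V.act_zero[OF g])
    next
      case (one xm)
      then show ?case
        using \<psi>_equiv[OF g] by (cases xm) (simp add: ext_of \<Psi>_frag)
    next
      case (diff a b)
      then show ?case
        using diff_in by (simp add: ext_def frag_extend_diff \<Psi>_diff V.act_diff[OF g] del: tensor_free_simps)
    qed
    then show ?thesis by blast
  qed
  have coset: "\<exists>c \<in> carrier ?F. S = ?K #>\<^bsub>?F\<^esub> c" if "S \<in> carrier (Icosa M)" for S
    using that by (auto simp: Icosa_def tensor_product_def FactGroup_def RCOSETS_def)
  have coset_in: "?K #>\<^bsub>?F\<^esub> c \<in> carrier (Icosa M)" if "c \<in> carrier ?F" for c
    using that by (auto simp: Icosa_def tensor_product_def FactGroup_def RCOSETS_def)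
  have h_coset: "?h (?K #>\<^bsub>?F\<^esub> c) = \<Psi> c" if c: "c \<in> carrier ?F" for c
  proof -
    have "\<Psi> (k + c) = \<Psi> c" if "k \<in> ?K" for k
      using that c \<Psi>_add[of k c] unfolding ker[symmetric] kernel_def by simp
    moreover have "0 \<in> ?K"
      using subgroup.one_closed[OF tensor_kernel_subgroup[OF module_icosa_lattice M]] by simp
    ultimately have "\<Psi> ` (?K #>\<^bsub>?F\<^esub> c) = {\<Psi> c}"
      by (auto simp: r_coset_def)
    then show ?thesis by simp
  qed
  \<comment> \<open>On cosets the action is given by representatives, because the extended map preserves the kernel.\<close>
  have act_coset: "Icosa_act \<alpha> \<gamma> M g (?K #>\<^bsub>?F\<^esub> c) = ?K #>\<^bsub>?F\<^esub> ext g c"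
    if g: "g \<in> A5" and c: "c \<in> carrier ?F" for g c
  proof -
    note closed = tensor_kernel_closed[OF module_icosa_lattice M]
    have ext_add: "ext g (k + c) = ext g k + ext g c" for k
      by (simp add: ext_def frag_extend_add)
    have ext_K: "ext g k \<in> ?K" if "k \<in> ?K" for k
      using that ext_in[OF g, of k] unfolding ker[symmetric] by (simp add: kernel_def V.act_zero[OF g])
    have z: "0 \<in> ?K"
      using subgroup.one_closed[OF tensor_kernel_subgroup[OF module_icosa_lattice M]] by simp
    have "Icosa_act \<alpha> \<gamma> M g (?K #>\<^bsub>?F\<^esub> c) = {k + ext g (k' + c) | k k'. k \<in> ?K \<and> k' \<in> ?K}"
      unfolding Icosa_act_def tensor_left_map_def ext_def[symmetric]
      by (auto simp: set_mult_def r_coset_def ext_def)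
    also have "\<dots> = {k + ext g c | k. k \<in> ?K}"
    proof (intro equalityI subsetI)
      fix u assume "u \<in> {k + ext g (k' + c) | k k'. k \<in> ?K \<and> k' \<in> ?K}"
      then obtain k k' where u: "u = (k + ext g k') + ext g c" "k \<in> ?K" "k' \<in> ?K"
        by (auto simp: ext_add add.assoc)
      then show "u \<in> {k + ext g c | k. k \<in> ?K}"
        using closed(1)[OF u(2) ext_K[OF u(3)]] by blast
    next
      fix u assume "u \<in> {k + ext g c | k. k \<in> ?K}"
      then obtain k where "u = k + ext g (0 + c)" "k \<in> ?K" by auto
      then show "u \<in> {k + ext g (k' + c) | k k'. k \<in> ?K \<and> k' \<in> ?K}"
        using z by blast
    qed
    also have "\<dots> = ?K #>\<^bsub>?F\<^esub> ext g c"
      by (auto simp: r_coset_def)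
    finally show ?thesis .
  qed
  interpret I: group "Icosa M"
  proof -
    have "normal ?K ?F"
      using comm_group.normal_iff_subgroup[OF tensor_free_comm_group]
        tensor_kernel_subgroup[OF module_icosa_lattice M] by blast
    then show "group (Icosa M)"
      unfolding Icosa_def tensor_product_def by (rule normal.factorgroup_is_group)
  qed
  let ?f = "inv_into (carrier (Icosa M)) ?h"
  have f: "?f \<in> iso (add_group :: 'v monoid) (Icosa M)"
    by (rule I.iso_set_sym[OF iso])
  have bij: "bij_betw ?h (carrier (Icosa M)) UNIV"
    using iso by (simp add: iso_def)
  have "?f (act g v) = Icosa_act \<alpha> \<gamma> M g (?f v)" if g: "g \<in> A5" for g v
  proof -
    have fv: "?f v \<in> carrier (Icosa M)" "?h (?f v) = v"
      using bij by (metis UNIV_I bij_betw_imp_surj_on inv_into_into, metis UNIV_I bij_betw_imp_surj_on f_inv_into_f)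
    obtain c where c: "c \<in> carrier ?F" "?f v = ?K #>\<^bsub>?F\<^esub> c"
      using coset[OF fv(1)] by blast
    have v: "v = \<Psi> c"
      using fv(2) h_coset[OF c(1)] unfolding c(2) by simp
    have "act g v = ?h (?K #>\<^bsub>?F\<^esub> ext g c)"
      using ext_in[OF g c(1)] h_coset[of "ext g c"] v by simp
    also have "?f \<dots> = ?K #>\<^bsub>?F\<^esub> ext g c"
      using bij coset_in ext_in[OF g c(1)] by (intro inv_into_f_f) (auto simp: bij_betw_def)
    finally show ?thesis unfolding act_coset[OF g c(1), symmetric] c(2)[symmetric] .
  qed
  then show ?thesis
    unfolding gmodule_isomorphic_def using f by blast
qed

section \<open>Transport from the standard generators\<close>

text \<open>The involution \<open>(2 4)(3 5)\<close> inverts \<open>sigma0\<close> and does not normalize the Klein four-group;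
  with \<open>\<alpha>\<close> and \<open>\<beta>\<close> it generates the group, as \<open>\<gamma> = \<beta>\<tau>\<close>.\<close>

definition "tau0 = beta0 \<circ> gamma0"

lemma tau0_in: "tau0 \<in> A5"
  unfolding tau0_def by (intro alt5_comp beta0_in gamma0_in)

lemma rotation_words:
  "conj_by beta0 alpha0 = alpha0" "conj_by sigma0 alpha0 = beta0"
  "conj_by tau0 sigma0 = sigma0 \<circ> sigma0" "sigma0 \<circ> sigma0 \<circ> sigma0 = id"
  "beta0 \<circ> tau0 = gamma0"
  "alpha0 \<noteq> id" "beta0 \<noteq> id" "sigma0 \<noteq> id" "tau0 \<noteq> id"
proof -
  show "conj_by beta0 alpha0 = alpha0"
    by (rule conj_byI[symmetric, OF alt5_bij[OF beta0_in]]) (simp add: gen0_defs)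
  show "conj_by sigma0 alpha0 = beta0"
    by (rule conj_byI[symmetric, OF alt5_bij[OF sigma0_in]]) (simp add: gen0_defs sigma0_def)
  show "conj_by tau0 sigma0 = sigma0 \<circ> sigma0"
    by (rule conj_byI[symmetric, OF alt5_bij[OF tau0_in]]) (simp add: gen0_defs sigma0_def tau0_def)
qed (simp_all add: gen0_defs sigma0_def tau0_def id_eq_perm5)

lemma trace_map_involution:
  assumes "gmodule Alt5 (add_group :: 'v::ab_group_add monoid) act" "\<alpha> \<in> A5" "group.ord Alt5 \<alpha> = 2"
  shows "trace_map Alt5 act \<alpha> v = v + act \<alpha> v"
proof -
  interpret additive_gmodule Alt5 act
    by (intro additive_gmodule.intro additive_gmodule_axioms.intro alt5_group assms(1))
  have "{..<2} = {0, 1::nat}" by auto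
  moreover have "\<alpha> [^]\<^bsub>Alt5\<^esub> (1::nat) = \<alpha>" "\<alpha> [^]\<^bsub>Alt5\<^esub> (0::nat) = \<one>\<^bsub>Alt5\<^esub>"
    using assms(2) by (simp_all only: nat_pow_eone nat_pow_0)
  ultimately show ?thesis
    using act_one[of v] by (simp add: trace_map_def assms(3) del: alt5_one One_nat_def)
qed

text \<open>Every involution lies in a configuration to which \<open>commuting_involution_inverts_axis\<close>
  applies, namely a relabelling of \<open>alpha0\<close>, \<open>beta0\<close>, \<open>sigma0\<close>, \<open>tau0\<close>. By halving, every
  fixed point of the involution is a trace and hence lies on its axis.\<close>

lemma rotation_module_standard_action:
  fixes act :: "(nat \<Rightarrow> nat) \<Rightarrow> 'v::ab_group_add \<Rightarrow> 'v"
  assumes rot: "rotation_module_3D Alt5 act (\<lambda>g. range (trace_map Alt5 act g))"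
    and nonaxial: "\<not> axial Alt5 act (\<lambda>g. range (trace_map Alt5 act g))"
    and inj: "\<And>v w :: 'v. v + v = w + w \<Longrightarrow> v = w"
    and surj: "\<And>v :: 'v. \<exists>w. v = w + w"
    and x: "x permutes {1..5}"
  shows "standard_icosahedral_action (\<lambda>p. act (conj_by x p))"
proof -
  have gm: "gmodule Alt5 (add_group :: 'v monoid) act"
    using rot by (simp add: rotation_module_3D_def)
  interpret V: additive_gmodule Alt5 act
    by (intro additive_gmodule.intro additive_gmodule_axioms.intro alt5_group gm)
  note b = permutes_bij[OF x]
  let ?q = "conj_by x"
  note q = conj_by_in_alt5[OF x]
  have gens: "icosa_generators (?q alpha0) (?q gamma0)" by (rule icosa_generators_standard[OF x])
  have ord: "group.ord Alt5 (?q alpha0) = 2" using gens by (simp add: icosa_generators_def)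
  have tr: "trace_map Alt5 act (?q alpha0) v = v + act (?q alpha0) v" for v
    by (rule trace_map_involution[OF gm q[OF alpha0_in] ord])
  have conj: "?q h \<otimes>\<^bsub>Alt5\<^esub> ?q g \<otimes>\<^bsub>Alt5\<^esub> inv\<^bsub>Alt5\<^esub> ?q h = ?q (conj_by h g)" if "h \<in> A5" "g \<in> A5" for h g
    using conj_by_conj_by_distrib[OF x that(1), of g] q[OF that(1)]
    by (simp add: alt5_m_inv conj_by_def[of "?q h"])
  have gen: "generate Alt5 {?q alpha0, ?q beta0, ?q tau0} = A5"
  proof (intro equalityI)
    show "generate Alt5 {?q alpha0, ?q beta0, ?q tau0} \<subseteq> A5"
      by (rule V.generate_incl) (use q alpha0_in beta0_in tau0_in in auto)
    have "?q gamma0 = ?q beta0 \<otimes>\<^bsub>Alt5\<^esub> ?q tau0"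
      by (simp add: conj_by_comp[OF b, symmetric] rotation_words)
    then have "?q gamma0 \<in> generate Alt5 {?q alpha0, ?q beta0, ?q tau0}"
      by (simp only:) (intro generate.eng generate.incl; simp)
    then have "generate Alt5 {?q alpha0, ?q gamma0} \<subseteq> generate Alt5 {?q alpha0, ?q beta0, ?q tau0}"
      using q alpha0_in beta0_in tau0_in
      by (intro V.generate_subgroup_incl V.generate_is_subgroup) (auto intro: generate.incl)
    then show "A5 \<subseteq> generate Alt5 {?q alpha0, ?q beta0, ?q tau0}"
      using gens by (simp add: icosa_generators_def)
  qed
  have inverts: "act (?q beta0) l = - l" if "act (?q alpha0) l = l" for l
  proof -
    obtain w where w: "l = w + w" using surj by blast
    have "act (?q alpha0) w + act (?q alpha0) w = w + w"
      using that unfolding w by (simp add: V.act_add q alpha0_in)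
    then have "act (?q alpha0) w = w" by (rule inj)
    then have l: "l \<in> range (trace_map Alt5 act (?q alpha0))"
      unfolding w by (intro image_eqI[of _ _ w]) (simp_all add: tr)
    have sinv: "inv\<^bsub>Alt5\<^esub> ?q sigma0 = ?q (sigma0 \<circ> sigma0)"
      using q[OF sigma0_in] q[OF alt5_comp[OF sigma0_in sigma0_in]]
      by (intro V.inv_equality) (simp_all add: conj_by_comp[OF b, symmetric] rotation_words conj_by_id[OF b])
    show ?thesis
    proof (rule V.commuting_involution_inverts_axis[where \<alpha> = "?q alpha0" and \<beta> = "?q beta0"
          and \<sigma> = "?q sigma0" and \<tau> = "?q tau0" and a = l, OF rot nonaxial])
      show "l \<in> range (trace_map Alt5 act (?q alpha0))" by (rule l)
      show "generate Alt5 {?q alpha0, ?q beta0, ?q tau0} = A5" by (rule gen)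
      show "v + v = 0 \<Longrightarrow> v = 0" for v :: 'v using inj[of v 0] by simp
      show "?q sigma0 \<otimes>\<^bsub>Alt5\<^esub> ?q sigma0 \<otimes>\<^bsub>Alt5\<^esub> ?q sigma0 = \<one>\<^bsub>Alt5\<^esub>"
        by (simp add: conj_by_comp[OF b, symmetric] rotation_words conj_by_id[OF b])
      show "?q tau0 \<otimes>\<^bsub>Alt5\<^esub> ?q sigma0 \<otimes>\<^bsub>Alt5\<^esub> inv\<^bsub>Alt5\<^esub> ?q tau0 = inv\<^bsub>Alt5\<^esub> ?q sigma0"
        by (simp only: sinv conj tau0_in sigma0_in rotation_words)
    qed (simp_all only: conj alpha0_in beta0_in sigma0_in tau0_in q rotation_words alt5_one
        conj_by_eq_id[OF b] not_False_eq_True)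
  qed
  show ?thesis
  proof (intro standard_icosahedral_action.intro standard_icosahedral_action_axioms.intro
      additive_gmodule.intro additive_gmodule_axioms.intro alt5_group)
    show "gmodule Alt5 add_group (\<lambda>p. act (?q p))"
    proof (rule gmoduleI)
      show "comm_group (add_group :: 'v monoid)" by (rule comm_group_add_group)
      show "act (?q \<one>\<^bsub>Alt5\<^esub>) v = v" for v
        using V.act_one[of v] by (simp only: alt5_one conj_by_id[OF b])
      show "act (?q (g \<otimes>\<^bsub>Alt5\<^esub> h)) v = act (?q g) (act (?q h) v)" if "g \<in> A5" "h \<in> A5" for g h v
        using V.act_mult[OF q[OF that(1)] q[OF that(2)]] by (simp add: conj_by_comp[OF b])
    qed (simp_all add: alt5_group V.act_add q)
    show "v + v = w + w \<Longrightarrow> v = w" for v w :: 'v by (rule inj)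
    show "\<exists>w. v = w + w" for v :: 'v by (rule surj)
    show "act (?q alpha0) l = l \<Longrightarrow> act (?q beta0) l = - l" for l by (rule inverts)
  qed
qed

context
  fixes act :: "(nat \<Rightarrow> nat) \<Rightarrow> 'v::ab_group_add \<Rightarrow> 'v"
    and \<alpha> \<gamma> x :: "nat \<Rightarrow> nat" and C :: "(nat \<Rightarrow> nat) set"
  assumes gm: "gmodule Alt5 (add_group :: 'v monoid) act"
    and x: "x permutes {1..5}" "\<alpha> = conj_by x alpha0" "\<gamma> = conj_by x gamma0"
    and std: "standard_icosahedral_action (\<lambda>p. act (conj_by x p))"
    and C: "C = conj_class Alt5 (\<alpha> \<circ> \<gamma>)"
begin

interpretation V: additive_gmodule Alt5 act
  by (intro additive_gmodule.intro additive_gmodule_axioms.intro alt5_group gm)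

interpretation S: standard_icosahedral_action "\<lambda>p. act (conj_by x p)"
  by (rule std)

lemma generators: "icosa_generators \<alpha> \<gamma>"
  unfolding x(2,3) by (rule icosa_generators_standard[OF x(1)])

lemma axis_eq: "range (trace_map Alt5 act \<alpha>) = S.axis0"
proof -
  have "\<alpha> \<in> A5" "group.ord Alt5 \<alpha> = 2" using generators by (auto simp: icosa_generators_def)
  note tr = trace_map_involution[OF gm this]
  have "l \<in> range (trace_map Alt5 act \<alpha>)" if l: "l \<in> S.axis0" for l
  proof -
    obtain m where "m \<in> S.axis0" "l = m + m" using S.axis0_half[OF l] .
    then show ?thesis by (intro image_eqI[of _ _ m]) (simp_all add: tr x(2)[symmetric])
  qed
  moreover have "trace_map Alt5 act \<alpha> v \<in> S.axis0" for v
    using S.trace_in_axis0[of v] by (simp only: tr x(2)[symmetric])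
  ultimately show ?thesis by blast
qed

lemma C_eq: "C = conj_by x ` vertices0"
  unfolding C x(2,3) conj_by_comp[OF permutes_bij[OF x(1)], symmetric] conj_class_conj_by[OF x(1)] conj_class0 ..

lemma class_sum: "(\<Sum>g\<in>C. act g v) = (\<Sum>p\<in>vertices0. act (conj_by x p) v)"
proof -
  have "inj_on (conj_by x) vertices0"
    using conj_by_inverse[OF permutes_bij[OF x(1)]] by (intro inj_on_inverseI)
  then show ?thesis unfolding C_eq by (simp add: sum.reindex)
qed

lemma phi_endo_axis: "l \<in> S.axis0 \<Longrightarrow> phi_endo act C l = S.T gamma0 l"
  unfolding phi_endo_def class_sum
  by (simp add: S.class_sum_eq_T quarter_eq[OF S.double_inj])

lemma phi_endo_add: "phi_endo act C (v + w) = phi_endo act C v + phi_endo act C w"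
proof -
  have C5: "g \<in> A5" if "g \<in> C" for g
    using that conj_by_in_alt5[OF x(1)] vertices0_subset unfolding C_eq by blast
  have quarter_add: "quarter (u + w) = quarter u + quarter w" for u w :: 'v
  proof -
    have four: "\<exists>v'. v = v' + v' + v' + v'" for v :: 'v
    proof -
      obtain v1 where v1: "v = v1 + v1" using S.double_surj by blast
      obtain v2 where v2: "v1 = v2 + v2" using S.double_surj by blast
      show ?thesis by (rule exI[of _ v2]) (simp only: v1 v2 add.assoc)
    qed
    obtain u' where "u = u' + u' + u' + u'" using four[of u] by blast
    moreover obtain w' where "w = w' + w' + w' + w'" using four[of w] by blast
    moreover have "(u' + u' + u' + u') + (w' + w' + w' + w')
        = (u' + w') + (u' + w') + (u' + w') + (u' + w')"
      by (simp add: algebra_simps)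
    ultimately show ?thesis
      by (simp only: quarter_eq[OF S.double_inj])
  qed
  show ?thesis
    unfolding phi_endo_def by (simp add: V.act_add C5 sum.distrib quarter_add cong: sum.cong)
qed

lemma phi_endo_closed: "l \<in> S.axis0 \<Longrightarrow> phi_endo act C l \<in> S.axis0"
  using S.T_fixed by (simp add: phi_endo_axis)

lemma phi_endo_golden: "l \<in> S.axis0 \<Longrightarrow> phi_endo act C (phi_endo act C l) = phi_endo act C l + l"
  using phi_endo_closed[of l] by (simp add: phi_endo_axis S.T_T_gamma0)

lemma axis_subgroup: "subgroup S.axis0 (add_group :: 'v monoid)"
  by (rule group.subgroupI)
    (use S.axis0_add S.axis0_minus comm_group_add_group in \<open>auto simp: comm_group_def intro: exI[of _ 0] S.act_zero[OF alpha0_in]\<close>)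

lemma axis_golden_module: "module golden_ring (axis_module act \<alpha> C)"
  by (rule module_golden_axis) (simp_all only: axis_eq axis_subgroup phi_endo_add phi_endo_closed phi_endo_golden)

lemma isomorphic_Icosa:
  "gmodule_isomorphic Alt5 (add_group :: 'v monoid) act
     (Icosa (axis_module act \<alpha> C)) (Icosa_act \<alpha> \<gamma> (axis_module act \<alpha> C))"
proof -
  let ?M = "axis_module act \<alpha> C"
  interpret M: module golden_ring ?M by (rule axis_golden_module)
  have car: "carrier ?M = S.axis0" by (simp add: axis_module_def axis_eq)
  have ops: "a \<oplus>\<^bsub>?M\<^esub> b = a + b" "\<zero>\<^bsub>?M\<^esub> = 0" "golden_phi \<odot>\<^bsub>?M\<^esub> a = phi_endo act C a" for a b
    by (simp_all add: axis_module_def golden_phi_def zmult_simps)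
  have neg: "\<ominus>\<^bsub>?M\<^esub> a = - a" if "a \<in> S.axis0" for a
    by (rule M.minus_equality) (use that S.axis0_minus in \<open>simp_all add: ops car\<close>)
  show ?thesis
  proof (rule Icosa_isomorphic[where E = S.from_axes, OF axis_golden_module gm generators])
    show "S.from_axes (a \<oplus>\<^bsub>?M\<^esub> a') (b \<oplus>\<^bsub>?M\<^esub> b') (c \<oplus>\<^bsub>?M\<^esub> c') = S.from_axes a b c + S.from_axes a' b' c'" for a b c a' b' c'
      by (simp add: ops S.from_axes_add)
    show "a = \<zero>\<^bsub>?M\<^esub> \<and> b = \<zero>\<^bsub>?M\<^esub> \<and> c = \<zero>\<^bsub>?M\<^esub>"
      if "a \<in> carrier ?M" "b \<in> carrier ?M" "c \<in> carrier ?M" "S.from_axes a b c = 0" for a b c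
      using S.from_axes_eq_0 that unfolding car ops by blast
    show "\<exists>a\<in>carrier ?M. \<exists>b\<in>carrier ?M. \<exists>c\<in>carrier ?M. v = S.from_axes a b c" for v
      using S.from_axes_surj[of v] unfolding car by blast
    show "act \<alpha> (S.from_axes a b c)
      = S.from_axes (\<ominus>\<^bsub>?M\<^esub> a) (\<ominus>\<^bsub>?M\<^esub> b) (c \<oplus>\<^bsub>?M\<^esub> golden_phi \<odot>\<^bsub>?M\<^esub> (a \<oplus>\<^bsub>?M\<^esub> b))"
      if abc: "a \<in> carrier ?M" "b \<in> carrier ?M" "c \<in> carrier ?M" for a b c
    proof -
      note abc' = abc[unfolded car]
      have "act \<alpha> (S.from_axes a b c) = S.from_axes (- a) (- b) (c + S.T gamma0 (a + b))"
        using S.from_axes_alpha0[OF abc'] x(2) by (simp add: S.T_add gamma0_in add.assoc)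
      then show ?thesis
        unfolding ops neg[OF abc'(1)] neg[OF abc'(2)] phi_endo_axis[OF S.axis0_add[OF abc'(1,2)]] .
    qed
    show "act \<gamma> (S.from_axes a b c) = S.from_axes b c a" for a b c
      using S.from_axes_gamma0 by (simp add: x(3))
  qed
qed

end

theorem corollary2p1:
  fixes act :: "(nat \<Rightarrow> nat) \<Rightarrow> 'v::ab_group_add \<Rightarrow> 'v"
    and \<alpha> c :: "nat \<Rightarrow> nat" and C :: "(nat \<Rightarrow> nat) set"
  assumes "rotation_module_3D Alt5 act (\<lambda>g. range (trace_map Alt5 act g))"
    and "\<not> axial Alt5 act (\<lambda>g. range (trace_map Alt5 act g))"
    and "uniquely_p_divisible TYPE('v) 2"
    and "prime_characteristic TYPE('v) \<or> divisible TYPE('v)"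
    and "\<alpha> \<in> carrier Alt5" and "group.ord Alt5 \<alpha> = 2"
    and "c \<in> five_cycles" and "C = conj_class Alt5 c"
  shows "phi_endo act C ` range (trace_map Alt5 act \<alpha>) \<subseteq> range (trace_map Alt5 act \<alpha>) \<and>
    (\<forall>l \<in> range (trace_map Alt5 act \<alpha>). phi_endo act C (phi_endo act C l) = phi_endo act C l + l) \<and>
    module golden_ring (axis_module act \<alpha> C) \<and>
    (\<exists>\<gamma>. icosa_generators \<alpha> \<gamma> \<and> \<alpha> \<otimes>\<^bsub>Alt5\<^esub> \<gamma> \<in> C) \<and>
    (\<forall>\<gamma>. icosa_generators \<alpha> \<gamma> \<and> \<alpha> \<otimes>\<^bsub>Alt5\<^esub> \<gamma> \<in> C \<longrightarrow>
      gmodule_isomorphic Alt5 (add_group :: 'v monoid) act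
        (Icosa (axis_module act \<alpha> C)) (Icosa_act \<alpha> \<gamma> (axis_module act \<alpha> C)))"
proof -
  have unique: "\<exists>!w. v = w + w" for v :: 'v
    using assms(3) by (simp add: uniquely_p_divisible_def numeral_2_eq_2)
  then have inj: "v + v = w + w \<Longrightarrow> v = w" and surj: "\<exists>w. v = w + w" for v w :: 'v
    by metis+
  have gm: "gmodule Alt5 (add_group :: 'v monoid) act"
    using assms(1) by (simp add: rotation_module_3D_def)
  have C: "C = conj_class Alt5 (\<alpha> \<circ> \<gamma>)" if "\<alpha> \<otimes>\<^bsub>Alt5\<^esub> \<gamma> \<in> C" for \<gamma>
    using conj_class_eq[of "\<alpha> \<circ> \<gamma>" c] that assms(8) by simp
  have standard: "\<exists>x. x permutes {1..5} \<and> \<alpha> = conj_by x alpha0 \<and> \<gamma> = conj_by x gamma0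
      \<and> standard_icosahedral_action (\<lambda>p. act (conj_by x p))"
    if "icosa_generators \<alpha> \<gamma>" for \<gamma>
    using icosa_generators_conj_standard[OF that]
      rotation_module_standard_action[OF assms(1,2) inj surj] by metis
  have ex: "\<exists>\<gamma>. icosa_generators \<alpha> \<gamma> \<and> \<alpha> \<otimes>\<^bsub>Alt5\<^esub> \<gamma> \<in> C"
    using icosa_generators_exist[OF assms(5-7)] assms(8) by simp
  then obtain \<gamma> where \<gamma>: "icosa_generators \<alpha> \<gamma>" "\<alpha> \<otimes>\<^bsub>Alt5\<^esub> \<gamma> \<in> C" by blast
  obtain x where x: "x permutes {1..5}" "\<alpha> = conj_by x alpha0" "\<gamma> = conj_by x gamma0"
      "standard_icosahedral_action (\<lambda>p. act (conj_by x p))"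
    using standard[OF \<gamma>(1)] by blast
  note hyps = gm x C[OF \<gamma>(2)]
  note ax = axis_eq[OF hyps]
  have "phi_endo act C ` range (trace_map Alt5 act \<alpha>) \<subseteq> range (trace_map Alt5 act \<alpha>)"
    unfolding ax using phi_endo_closed[OF hyps] by blast
  moreover have "\<forall>l \<in> range (trace_map Alt5 act \<alpha>). phi_endo act C (phi_endo act C l) = phi_endo act C l + l"
    unfolding ax using phi_endo_golden[OF hyps] by blast
  moreover have "gmodule_isomorphic Alt5 (add_group :: 'v monoid) act
        (Icosa (axis_module act \<alpha> C)) (Icosa_act \<alpha> \<gamma> (axis_module act \<alpha> C))"
    if g: "icosa_generators \<alpha> \<gamma>" "\<alpha> \<otimes>\<^bsub>Alt5\<^esub> \<gamma> \<in> C" for \<gamma>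
  proof -
    obtain x where "x permutes {1..5}" "\<alpha> = conj_by x alpha0" "\<gamma> = conj_by x gamma0"
        "standard_icosahedral_action (\<lambda>p. act (conj_by x p))"
      using standard[OF g(1)] by blast
    then show ?thesis using isomorphic_Icosa[OF gm _ _ _ _ C[OF g(2)]] by blast
  qed
  ultimately show ?thesis
    using axis_golden_module[OF hyps] ex by blast
qed

end
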